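(* Let $n\in\mathbb{N}$, let $\mathcal{C}$ be any category of two-colored partitions, let $G$ be the unitary easy compact quantum group of $(\mathcal{C},n)$ and let $u=(u_{j,i})_{j,i=1}^n$ be its fundamental representation. Say that $\mathcal{C}$ has property (1) if and only if each block of each two-colored partition of $\mathcal{C}$ has at most two points, (2) if and only if each block of each two-colored partition of $\mathcal{C}$ has at least two points, (3) if and only if each block with at least two points of each two-colored partition of $\mathcal{C}$ contains as many white lower and black upper points (together) as it does black lower and white upper points (together), (4) if and only if each two-colored partition of $\mathcal{C}$ has as many white lower and black upper points (together) as it has black lower and white upper points (together). Then an isomorphism of complex vector spaces from the first quantum group cohomology with trivial coefficients $H^1(\widehat{G})$ to the subspace $$\{v\in M_n(\mathbb{C}) \mid A(\mathcal{C},v)\}\cong\mathbb{C}^{\oplus\beta_1(\widehat{G})}$$ of $M_n(\mathbb{C})$ is defined by the rule which assigns to (the one-element cohomology class of) any $1$-cocycle $\eta$ the matrix $(\eta(u_{j,i}))_{(j,i)\in\{1,\dots,n\}^2}$, where $\beta_1(\widehat{G})$ and, for any $v\in M_n(\mathbb{C})$, the predicate $A(\mathcal{C},v)$ are as follows ($I$ is the identity matrix): - If $\mathcal{C}$ is $1\wedge 2\wedge 3$: $A(\mathcal{C},v)$ is always true; $\beta_1(\widehat{G})=n^2$. - If $1\wedge\neg 2\wedge 3\wedge 4$: there is $\lambda\in\mathbb{C}$ such that $v-\lambda I$ is small; $\beta_1(\widehat{G})=(n-1)^2+1$. - If $1\wedge\neg 2\wedge 3\wedge\neg 4$: $v$ is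 small; $\beta_1(\widehat{G})=(n-1)^2$. - If $1\wedge 2\wedge\neg 3\wedge 4$: there is $\lambda\in\mathbb{C}$ such that $v-\lambda I$ is skew-symmetric; $\beta_1(\widehat{G})=\frac12 n(n-1)+1$. - If $1\wedge 2\wedge\neg 3\wedge\neg 4$: $v$ is skew-symmetric; $\beta_1(\widehat{G})=\frac12 n(n-1)$. - If $1\wedge\neg 2\wedge\neg 3\wedge 4$: there is $\lambda\in\mathbb{C}$ such that $v-\lambda I$ is skew-symmetric and small; $\beta_1(\widehat{G})=\frac12(n-1)(n-2)+1$. - If $1\wedge\neg 2\wedge\neg 3\wedge\neg 4$: $v$ is skew-symmetric and small; $\beta_1(\widehat{G})=\frac12(n-1)(n-2)$. - If $\neg 1\wedge 2\wedge 3\wedge 4$: $v$ is diagonal; $\beta_1(\widehat{G})=n$. - If $\neg 1\wedge\neg 3\wedge 4$: there is $\lambda\in\mathbb{C}$ such that $v-\lambda I=0$; $\beta_1(\widehat{G})=1$. - If $\neg 1\wedge\neg 3\wedge\neg 4$: $v=0$; $\beta_1(\widehat{G})=0$. And these are all the cases that can occur.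
   Context: Conventions: $0\notin\mathbb{N}$, $\mathbb{N}_0=\mathbb{N}\cup\{0\}$, $[k]=\{1,\dots,k\}$, $[0]=\emptyset$. A matrix in $M_n(\mathbb{C})$ is small if each of its rows and each of its columns sums to $0$; it is skew-symmetric if $v=-v^{\mathrm t}$. Algebras are associative and unital. Two-colored partitions. For $k,\ell\in\mathbb{N}_0$ let $\Pi^k_\ell$ be the set of $k+\ell$ pairwise distinct points consisting of $k$ upper points $1^\uparrow,\dots,k^\uparrow$ and $\ell$ lower points $1^\downarrow,\dots,\ell^\downarrow$. The colors are $\circ$ (white) and $\bullet$ (black). A two-colored partition is a triple $(c,d,p)$ where for some $k,\ell\in\mathbb{N}_0$ one has $c:[k]\to\{\circ,\bullet\}$ (upper coloring), $d:[\ell]\to\{\circ,\bullet\}$ (lower coloring) and $p$ is a set-theoretical partition of $\Pi^k_\ell$ (a set of non-empty pairwise disjoint subsets, called blocks, with union $\Pi^k_\ell$). The point $a^\uparrow$ has color $c_a$, the point $b^\downarrow$ has color $d_b$. A category of two-colored partitions is a set $\mathcal{C}$ of two-colored partitions such that: (i) $\mathcal{C}$ contains $(\circ,\circ,\{\{1^\uparrow,1^\downarrow\}\})$, $(\bullet,\bullet,\{\{1^\uparrow,1^\downarrow\}\})$, $(\emptyset,\circ\bullet,\{\{1^\downarrow,2^\downarrow\}\})$, $(\emptyset,\bullet\circ,\{\{1^\downarrow,2^\downarrow\}\})$, $(\bullet\circ,\emptyset,\{\{1^\uparrow,2^\uparrow\}\})$ and $(\circ\bullet,\emptyset,\{\{1^\uparrow,2^\uparrow\}\})$;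 (ii) $\mathcal{C}$ is closed under adjoints $(c,d,p)\mapsto(d,c,p^* )$, where $p^*$ is obtained by exchanging upper and lower points ($a^\uparrow\leftrightarrow a^\downarrow$); (iii) $\mathcal{C}$ is closed under tensor products (horizontal concatenation): $(c_1,d_1,p_1),(c_2,d_2,p_2)\mapsto(c_1c_2,d_1d_2,p_1\otimes p_2)$, where the colorings are concatenated and $p_1\otimes p_2$ is the union of $p_1$ and of $p_2$ with its upper points shifted by the number of upper points of $p_1$ and its lower points shifted by the number of lower points of $p_1$; (iv) $\mathcal{C}$ is closed under composition (vertical concatenation): $(c,d,p),(d,e,q)\mapsto(c,e,qp)$, where, if $p$ is a partition of $\Pi^k_\ell$ and $q$ one of $\Pi^\ell_m$, one identifies the lower point $b^\downarrow$ of $p$ with the upper point $b^\uparrow$ of $q$ for each $b\in[\ell]$, takes the equivalence relation on the resulting $k+\ell+m$ points generated by the blocks of $p$ and $q$, and lets the blocks of $qp$ be the non-empty intersections of its classes with the set of the $k$ upper points of $p$ and the $m$ lower points of $q$. Relations. Let $E=\{u^\circ_{j,i},u^\bullet_{j,i}\}_{i,j=1}^n$ be a set of $2n^2$ elements and $\mathbb{C}\langle E\rangle$ the free algebra over $E$. For $g\in[n]^k$ and $j\in[n]^\ell$ let $g\diamond j:\Pi^k_\ell\to[n]$ be the map $a^\uparrow\mapsto g_a$, $b^\downarrow\mapsto j_b$. The kernel $\ker(f)$ of a map $f$ is the set of its non-empty fibers (a partition of the domain). For partitions $p,q$ of the same set, $p\le q$ means every block of $p$ is contained in a block of $q$; $\zeta(p,q)=1$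 if $p\le q$ and $\zeta(p,q)=0$ otherwise. For a two-colored partition $(c,d,p)$ with $p$ a partition of $\Pi^k_\ell$, $g\in[n]^k$, $j\in[n]^\ell$ put $$r^c_d(p)_{j,g}=\sum_{i\in[n]^\ell}\zeta(p,\ker(g\diamond i))\,u^{d_1}_{j_1,i_1}\cdots u^{d_\ell}_{j_\ell,i_\ell}-\sum_{h\in[n]^k}\zeta(p,\ker(h\diamond j))\,u^{c_1}_{h_1,g_1}\cdots u^{c_k}_{h_k,g_k}\in\mathbb{C}\langle E\rangle$$ (empty products are $1$, $[n]^0=\{\emptyset\}$). Let $R_{\mathcal{C}}$ be the set of all $r^c_d(p)_{j,g}$ with $(c,d,p)\in\mathcal{C}$, $g\in[n]^k$ and $j\in[n]^\ell$, where $k$ is the number of upper points and $\ell$ the number of lower points of $(c,d,p)$, and $J_{\mathcal{C}}$ the two-sided ideal generated by $R_{\mathcal{C}}$. Easy quantum groups and cohomology. The unitary easy compact quantum group $G$ of $(\mathcal{C},n)$ is the compact quantum group whose Hopf $*$-algebra $\mathbb{C}[\widehat{G}]$ has underlying algebra $\mathbb{C}\langle E\rangle/J_{\mathcal{C}}$, with $(u^{x}_{j,i}+J_{\mathcal{C}})^*=u^{\overline{x}}_{j,i}+J_{\mathcal{C}}$ (where $\overline{\circ}=\bullet$, $\overline{\bullet}=\circ$), comultiplication $u^x_{j,i}+J_{\mathcal C}\mapsto\sum_{s=1}^n(u^x_{j,s}+J_{\mathcal C})\otimes(u^x_{s,i}+J_{\mathcal C})$, and counit the unique algebra morphism $\epsilon$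 with $\epsilon(u^x_{j,i}+J_{\mathcal C})=\delta_{j,i}$, for $x\in\{\circ,\bullet\}$. Its fundamental representation is $u=(u_{j,i})$ with $u_{j,i}=u^\circ_{j,i}+J_{\mathcal C}$. The first quantum group cohomology $H^1(\widehat{G})$ with trivial coefficients of the discrete dual $\widehat{G}$ is the first Hochschild cohomology of the algebra $A=\mathbb{C}\langle E\rangle/J_{\mathcal C}$ with coefficients in the bimodule $\mathbb{C}$ with actions $a\cdot\lambda=\epsilon(a)\lambda$, $\lambda\cdot a=\lambda\epsilon(a)$: $1$-cocycles are linear $\eta:A\to\mathbb{C}$ with $\eta(ab)=\epsilon(a)\eta(b)+\eta(a)\epsilon(b)$ for all $a,b\in A$; the only $1$-coboundary is $0$, so every cohomology class has exactly one element. *)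

theory Defs
  imports
    "HOL-Analysis.Analysis"
    "HOL-Algebra.QuotRing"
    "HOL-Algebra.Module"
    "HOL-Library.Disjoint_Sets"
    "HOL-Library.Poly_Mapping"
begin

section \<open>Two-colored partitions\<close>

datatype color = White | Black

text \<open>\<open>Up a\<close> and \<open>Lo b\<close> are the upper point $a^\uparrow$ and the lower point $b^\downarrow$;
  points are numbered from 1, whereas list positions are numbered from 0.\<close>

datatype point = Up nat | Lo nat

definition points :: "nat \<Rightarrow> nat \<Rightarrow> point set" where
  "points k l = Up ` {1..k} \<union> Lo ` {1..l}"

type_synonym tcp = "color list \<times> color list \<times> point set set"

definition two_colored_partitions :: "tcp set" where
  "two_colored_partitions = {(c, d, p). partition_on (points (length c) (length d)) p}"

fun flip_point :: "point \<Rightarrow> point" where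
  "flip_point (Up a) = Lo a"
| "flip_point (Lo b) = Up b"

definition adjoint_partition :: "point set set \<Rightarrow> point set set" where
  "adjoint_partition p = (\<lambda>B. flip_point ` B) ` p"

fun shift_point :: "nat \<Rightarrow> nat \<Rightarrow> point \<Rightarrow> point" where
  "shift_point k l (Up a) = Up (k + a)"
| "shift_point k l (Lo b) = Lo (l + b)"

text \<open>Here \<open>k\<close> and \<open>l\<close> are the numbers of upper and lower points of \<open>p\<close>.\<close>

definition tensor_partition ::
    "nat \<Rightarrow> nat \<Rightarrow> point set set \<Rightarrow> point set set \<Rightarrow> point set set" where
  "tensor_partition k l p q = p \<union> (\<lambda>B. shift_point k l ` B) ` q"

text \<open>In the composition of \<open>p\<close> (above) with \<open>q\<close> (below), the upper points of \<open>p\<close> become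
  \<open>Top\<close> points, the lower points of \<open>q\<close> become \<open>Bot\<close> points, and the lower points of \<open>p\<close> are
  identified with the upper points of \<open>q\<close> as \<open>Mid\<close> points.\<close>

datatype glued_point = Top nat | Mid nat | Bot nat

fun glue_above :: "point \<Rightarrow> glued_point" where
  "glue_above (Up a) = Top a"
| "glue_above (Lo b) = Mid b"

fun glue_below :: "point \<Rightarrow> glued_point" where
  "glue_below (Up b) = Mid b"
| "glue_below (Lo m) = Bot m"

fun outer_point :: "point \<Rightarrow> glued_point" where
  "outer_point (Up a) = Top a"
| "outer_point (Lo m) = Bot m"

text \<open>The classes of the equivalence relation on \<open>\<Union>F\<close> generated by a family \<open>F\<close> of sets.
  The relation of lying in a common member of \<open>F\<close> is already symmetric, and reflexive
  on \<open>\<Union>F\<close>, so that its transitive closure is the generated equivalence relation.\<close>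

definition generated_classes :: "'a set set \<Rightarrow> 'a set set" where
  "generated_classes F = \<Union>F // {(x, y). \<exists>B\<in>F. x \<in> B \<and> y \<in> B}\<^sup>+"

definition compose_partition :: "point set set \<Rightarrow> point set set \<Rightarrow> point set set" where
  "compose_partition p q =
     (\<lambda>K. outer_point -` K) `
       generated_classes ((\<lambda>B. glue_above ` B) ` p \<union> (\<lambda>B. glue_below ` B) ` q) - {{}}"

definition partition_category :: "tcp set \<Rightarrow> bool" where
  "partition_category C \<longleftrightarrow>
     C \<subseteq> two_colored_partitions \<and>
     {([White], [White], {{Up 1, Lo 1}}),
      ([Black], [Black], {{Up 1, Lo 1}}),
      ([], [White, Black], {{Lo 1, Lo 2}}),
      ([], [Black, White], {{Lo 1, Lo 2}}),
      ([Black, White], [], {{Up 1, Up 2}}),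
      ([White, Black], [], {{Up 1, Up 2}})} \<subseteq> C \<and>
     (\<forall>c d p. (c, d, p) \<in> C \<longrightarrow> (d, c, adjoint_partition p) \<in> C) \<and>
     (\<forall>c1 d1 p1 c2 d2 p2. (c1, d1, p1) \<in> C \<longrightarrow> (c2, d2, p2) \<in> C \<longrightarrow>
        (c1 @ c2, d1 @ d2, tensor_partition (length c1) (length d1) p1 p2) \<in> C) \<and>
     (\<forall>c d e p q. (c, d, p) \<in> C \<longrightarrow> (d, e, q) \<in> C \<longrightarrow> (c, e, compose_partition p q) \<in> C)"

subsection \<open>The four properties\<close>

definition white_lower_black_upper :: "color list \<Rightarrow> color list \<Rightarrow> point set" where
  "white_lower_black_upper c d =
     {Lo b | b. b \<in> {1..length d} \<and> d ! (b - 1) = White} \<union>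
     {Up a | a. a \<in> {1..length c} \<and> c ! (a - 1) = Black}"

definition black_lower_white_upper :: "color list \<Rightarrow> color list \<Rightarrow> point set" where
  "black_lower_white_upper c d =
     {Lo b | b. b \<in> {1..length d} \<and> d ! (b - 1) = Black} \<union>
     {Up a | a. a \<in> {1..length c} \<and> c ! (a - 1) = White}"

definition property1 :: "tcp set \<Rightarrow> bool" where
  "property1 C \<longleftrightarrow> (\<forall>(c, d, p)\<in>C. \<forall>B\<in>p. card B \<le> 2)"

definition property2 :: "tcp set \<Rightarrow> bool" where
  "property2 C \<longleftrightarrow> (\<forall>(c, d, p)\<in>C. \<forall>B\<in>p. card B \<ge> 2)"

definition property3 :: "tcp set \<Rightarrow> bool" where
  "property3 C \<longleftrightarrow> (\<forall>(c, d, p)\<in>C. \<forall>B\<in>p. card B \<ge> 2 \<longrightarrow>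
     card (B \<inter> white_lower_black_upper c d) = card (B \<inter> black_lower_white_upper c d))"

definition property4 :: "tcp set \<Rightarrow> bool" where
  "property4 C \<longleftrightarrow> (\<forall>(c, d, p)\<in>C.
     card (white_lower_black_upper c d) = card (black_lower_white_upper c d))"

section \<open>Free algebras\<close>

text \<open>The free monoid, written additively because the convolution product of \<open>Poly_Mapping\<close>
  expects an additive monoid of exponents. The free complex algebra over a set of letters is
  the monoid algebra of the free monoid.\<close>

datatype 'a free_monoid = Letters (letters: "'a list")

instantiation free_monoid :: (type) monoid_add
begin

definition "0 = Letters []"

definition "v + w = Letters (letters v @ letters w)"

instance
  by standard (simp_all add: zero_free_monoid_def plus_free_monoid_def)

end

text \<open>The letter \<open>(x, j, i)\<close> is $u^x_{j,i}$, and the type \<open>'n\<close> plays the role of \<open>[n]\<close>.\<close>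

type_synonym 'n poly_alg = "(color \<times> 'n \<times> 'n) free_monoid \<Rightarrow>\<^sub>0 complex"

definition gen_u :: "color \<Rightarrow> 'n \<Rightarrow> 'n \<Rightarrow> 'n poly_alg" where
  "gen_u x j i = Poly_Mapping.single (Letters [(x, j, i)]) 1"

definition free_algebra :: "(complex, 'n poly_alg) module" where
  "free_algebra = \<lparr>carrier = UNIV, mult = (*), one = 1, zero = 0, add = (+),
     smult = (\<lambda>a f. Poly_Mapping.single 0 a * f)\<rparr>"

section \<open>The relations and the algebra of an easy quantum group\<close>

text \<open>\<open>diamond g j\<close> is only meaningful on \<open>points (length g) (length j)\<close>.\<close>

fun diamond :: "'n list \<Rightarrow> 'n list \<Rightarrow> point \<Rightarrow> 'n" where
  "diamond g j (Up a) = g ! (a - 1)"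
| "diamond g j (Lo b) = j ! (b - 1)"

definition kernel_partition :: "'a set \<Rightarrow> ('a \<Rightarrow> 'b) \<Rightarrow> 'a set set" where
  "kernel_partition X f = (\<lambda>y. {x\<in>X. f x = y}) ` (f ` X)"

definition zeta :: "'a set \<Rightarrow> 'a set set \<Rightarrow> 'a set set \<Rightarrow> 'b::zero_neq_one" where
  "zeta X p q = of_bool (refines X p q)"

definition gen_u_prod :: "color list \<Rightarrow> 'n list \<Rightarrow> 'n list \<Rightarrow> 'n poly_alg" where
  "gen_u_prod c j i = (\<Prod>s\<leftarrow>[0..<length c]. gen_u (c ! s) (j ! s) (i ! s))"

definition relation_poly ::
    "color list \<Rightarrow> color list \<Rightarrow> point set set \<Rightarrow> 'n list \<Rightarrow> 'n list \<Rightarrow> 'n::finite poly_alg" where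
  "relation_poly c d p j g =
     (let k = length c; l = length d; X = points k l in
       (\<Sum>i | length i = l.
          zeta X p (kernel_partition X (diamond g i)) * gen_u_prod d j i)
     - (\<Sum>h | length h = k.
          zeta X p (kernel_partition X (diamond h j)) * gen_u_prod c h g))"

definition relations :: "tcp set \<Rightarrow> 'n::finite poly_alg set" where
  "relations C = {relation_poly c d p j g | c d p j g.
     (c, d, p) \<in> C \<and> length g = length c \<and> length j = length d}"

text \<open>\<open>genideal\<close> yields the generated two-sided ideal, as \<open>ideal\<close> demands absorption on both
  sides and no commutativity.\<close>

definition relation_ideal :: "tcp set \<Rightarrow> 'n::finite poly_alg set" where
  "relation_ideal C = genideal free_algebra (relations C)"

definition easy_algebra :: "tcp set \<Rightarrow> (complex, 'n::finite poly_alg set) module" where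
  "easy_algebra C =
     ring.extend (free_algebra Quot relation_ideal C)
       (module.fields (\<lambda>a X. \<Union>f\<in>X.
          a_r_coset free_algebra (relation_ideal C) (smult free_algebra a f)))"

definition easy_u :: "tcp set \<Rightarrow> color \<Rightarrow> 'n \<Rightarrow> 'n \<Rightarrow> 'n::finite poly_alg set" where
  "easy_u C x j i = a_r_coset free_algebra (relation_ideal C) (gen_u x j i)"

section \<open>First Hochschild cohomology with trivial coefficients\<close>

text \<open>Maps on the carrier of an algebra are represented by maps on the whole type which
  vanish outside the carrier.\<close>

definition linear_functionals :: "(complex, 'a) module \<Rightarrow> ('a \<Rightarrow> complex) set" where
  "linear_functionals A = {f.
     (\<forall>a. a \<notin> carrier A \<longrightarrow> f a = 0) \<and>
     (\<forall>a\<in>carrier A. \<forall>b\<in>carrier A. f (add A a b) = f a + f b) \<and>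
     (\<forall>z. \<forall>a\<in>carrier A. f (smult A z a) = z * f a)}"

definition characters :: "(complex, 'a) module \<Rightarrow> ('a \<Rightarrow> complex) set" where
  "characters A = {f \<in> linear_functionals A.
     f (one A) = 1 \<and> (\<forall>a\<in>carrier A. \<forall>b\<in>carrier A. f (mult A a b) = f a * f b)}"

definition cocycles1 :: "(complex, 'a) module \<Rightarrow> ('a \<Rightarrow> complex) \<Rightarrow> ('a \<Rightarrow> complex) set" where
  "cocycles1 A eps = {\<eta> \<in> linear_functionals A.
     \<forall>a\<in>carrier A. \<forall>b\<in>carrier A. \<eta> (mult A a b) = eps a * \<eta> b + \<eta> a * eps b}"

definition coboundaries1 :: "(complex, 'a) module \<Rightarrow> ('a \<Rightarrow> complex) \<Rightarrow> ('a \<Rightarrow> complex) set" where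
  "coboundaries1 A eps =
     range (\<lambda>z a. if a \<in> carrier A then eps a * z - z * eps a else 0)"

definition cohomology_class1 ::
    "(complex, 'a) module \<Rightarrow> ('a \<Rightarrow> complex) \<Rightarrow> ('a \<Rightarrow> complex) \<Rightarrow> ('a \<Rightarrow> complex) set" where
  "cohomology_class1 A eps \<eta> = {\<xi> \<in> cocycles1 A eps. (\<lambda>a. \<xi> a - \<eta> a) \<in> coboundaries1 A eps}"

definition cohomology1 ::
    "(complex, 'a) module \<Rightarrow> ('a \<Rightarrow> complex) \<Rightarrow> ('a \<Rightarrow> complex) set set" where
  "cohomology1 A eps = cohomology_class1 A eps ` cocycles1 A eps"

text \<open>Vector space operations of the quotient of cocycles by coboundaries. In the scalar
  multiple, the coboundary \<open>\<beta>\<close> makes the result a full class for the scalar 0 as well.\<close>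

definition class_add ::
    "('a \<Rightarrow> complex) set \<Rightarrow> ('a \<Rightarrow> complex) set \<Rightarrow> ('a \<Rightarrow> complex) set" where
  "class_add X Y = {\<lambda>a. \<xi> a + \<eta> a | \<xi> \<eta>. \<xi> \<in> X \<and> \<eta> \<in> Y}"

definition class_scale ::
    "(complex, 'a) module \<Rightarrow> ('a \<Rightarrow> complex) \<Rightarrow> complex \<Rightarrow> ('a \<Rightarrow> complex) set
      \<Rightarrow> ('a \<Rightarrow> complex) set" where
  "class_scale A eps z X = {\<lambda>a. z * \<xi> a + \<beta> a | \<xi> \<beta>. \<xi> \<in> X \<and> \<beta> \<in> coboundaries1 A eps}"

text \<open>The definite description is proper: all relations vanish under the character of the free
  algebra with $u^x_{j,i} \mapsto \delta_{j,i}$, and the generators determine a character.\<close>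

definition easy_counit :: "tcp set \<Rightarrow> 'n::finite poly_alg set \<Rightarrow> complex" where
  "easy_counit C = (THE eps. eps \<in> characters (easy_algebra C) \<and>
     (\<forall>x j i. eps (easy_u C x j i) = of_bool (j = i)))"

section \<open>Complex matrices\<close>

text \<open>The library only provides the real scalar multiplication on matrices.\<close>

definition cmat_scale :: "complex \<Rightarrow> complex^'n^'m \<Rightarrow> complex^'n^'m" where
  "cmat_scale z v = (\<chi> j. z *s (v $ j))"

global_interpretation cmat: vector_space cmat_scale
  by standard (simp_all add: cmat_scale_def vec_eq_iff algebra_simps)

definition small :: "complex^'n^'n \<Rightarrow> bool" where
  "small v \<longleftrightarrow> (\<forall>j. (\<Sum>i\<in>UNIV. v $ j $ i) = 0) \<and> (\<forall>i. (\<Sum>j\<in>UNIV. v $ j $ i) = 0)"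

definition skew_symmetric :: "complex^'n^'n \<Rightarrow> bool" where
  "skew_symmetric v \<longleftrightarrow> v = - transpose v"

definition diagonal_matrix :: "complex^'n^'n \<Rightarrow> bool" where
  "diagonal_matrix v \<longleftrightarrow> (\<forall>j i. j \<noteq> i \<longrightarrow> v $ j $ i = 0)"

text \<open>The assertion that \<open>\<eta> \<mapsto> (\<eta>(u\<^bsub>j,i\<^esub>))\<close> defines an isomorphism of complex vector spaces from
  the first cohomology onto the subspace of all matrices \<open>v\<close> with \<open>P v\<close>, whose dimension is
  \<open>b\<close>.\<close>

definition first_cohomology_is :: "tcp set \<Rightarrow> (complex^'n^'n \<Rightarrow> bool) \<Rightarrow> real \<Rightarrow> bool" where
  "first_cohomology_is C P b \<longleftrightarrow>
     (let A = easy_algebra C; eps = easy_counit C; H = cohomology1 A eps; W = {v. P v} in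
       cmat.subspace W \<and> real (cmat.dim W) = b \<and>
       (\<exists>\<Phi>. (\<forall>\<eta>\<in>cocycles1 A eps.
                \<Phi> (cohomology_class1 A eps \<eta>) = (\<chi> j i. \<eta> (easy_u C White j i))) \<and>
            bij_betw \<Phi> H W \<and>
            (\<forall>X\<in>H. \<forall>Y\<in>H. \<Phi> (class_add X Y) = \<Phi> X + \<Phi> Y) \<and>
            (\<forall>z. \<forall>X\<in>H. \<Phi> (class_scale A eps z X) = cmat_scale z (\<Phi> X))))"

end

theory Submission
  imports Defs
begin

text \<open>
  A cocycle of the quotient algebra is the same as a derivation over the counit of the free
  algebra that vanishes on all relations. A derivation is determined by its values on the
  letters, and the pair partitions which every category contains express the values on the black
  letters by those on the white ones. Therefore a cocycle is the same as a matrix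
  \<open>v\<close> that satisfies one linear equation for each partition of the category and
  each labelling of its points (\<open>derivation_relation_poly_defect\<close>,
  \<open>cocycle_of_solution\<close>, \<open>solution_of_cocycle\<close>). As the only
  coboundary is zero, these matrices are the cohomology (\<open>first_cohomology_isI\<close>).

  Such an equation sums, over all ways of changing one label so that the labelling becomes
  constant on blocks, an entry of \<open>v\<close> indexed by the old and the new label. Hence
  it is void unless at most one block has non-constant labels. If one block does, it says that
  an off-diagonal entry vanishes for a block with at least three points, and that two transposed
  entries add up to zero for a pair of two points of the same charge. If all labels are constant
  on blocks, it is a sum of separate functions of the block labels, each of which must then be
  constant: diagonal entries are constant as soon as a larger block has non-zero charge, and row
  and column sums are constant as soon as there is a singleton. What remains is one scalar times
  the total charge of the partition, and this decides whether a multiple of the identity may be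
  added. These conditions are collected in \<open>solutionsI\<close> and in the lemmas on
  solutions that follow it.

  That no other combinations of the properties occur is a matter of combinatorics
  (\<open>property_2_of_not_1_and_3\<close>): a singleton makes it possible to erase single
  points of blocks, which is incompatible with a block of at least three points when all blocks
  with at least two points are neutral. Finally, the dimensions are found by exhibiting
  positions at which the entries of the matrices can be chosen freely
  (\<open>basis_size_coordinates\<close>).
\<close>

section \<open>Blocks in categories of partitions\<close>

text \<open>A union of members of the family which all meet a single member of it is a class as
  soon as no further member of the family meets the union: these star-shaped classes are the only
  ones that have to be computed.\<close>

lemma generated_classesI:
  assumes "K \<noteq> {}" "K \<subseteq> \<Union>F"
    and closed: "\<And>B. B \<in> F \<Longrightarrow> B \<inter> K \<noteq> {} \<Longrightarrow> B \<subseteq> K"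
    and B0: "B0 \<in> F" "B0 \<noteq> {}" "B0 \<subseteq> K"
    and conn: "\<And>y. y \<in> K \<Longrightarrow> \<exists>B\<in>F. y \<in> B \<and> (B = B0 \<or> B \<inter> B0 \<noteq> {})"
  shows "K \<in> generated_classes F"
proof -
  let ?R = "{(x, y). \<exists>B\<in>F. x \<in> B \<and> y \<in> B}"
  obtain x0 where x0: "x0 \<in> B0" using B0 by auto
  have "?R\<^sup>+ `` {x0} = K"
  proof (intro equalityI subsetI)
    fix y assume "y \<in> ?R\<^sup>+ `` {x0}"
    then have "(x0, y) \<in> ?R\<^sup>+" by simp
    then show "y \<in> K"
      by (induction rule: trancl_induct) (use x0 B0 closed in blast)+
  next
    fix y assume "y \<in> K"
    then obtain B where B: "B \<in> F" "y \<in> B" "B = B0 \<or> B \<inter> B0 \<noteq> {}" using conn by blast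
    have "(x0, y) \<in> ?R\<^sup>+"
    proof (cases "B = B0")
      case True
      then show ?thesis using B x0 by (intro r_into_trancl) auto
    next
      case False
      then obtain z where "z \<in> B" "z \<in> B0" using B by auto
      then have "(x0, z) \<in> ?R" "(z, y) \<in> ?R" using B B0 x0 by auto
      then show ?thesis by (meson r_into_trancl trancl_into_trancl)
    qed
    then show "y \<in> ?R\<^sup>+ `` {x0}" by simp
  qed
  moreover have "x0 \<in> \<Union>F" using x0 B0 by auto
  ultimately show ?thesis unfolding generated_classes_def quotient_def by blast
qed

lemma inj_glue_above: "inj glue_above"
  by (rule injI) (metis glue_above.elims glued_point.distinct(1) glued_point.inject(1,2))

lemma inj_glue_below: "inj glue_below"
  by (rule injI) (metis glue_below.elims glued_point.distinct(5) glued_point.inject(2,3))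

lemma glue_below_eq_above_iff: "glue_below y = glue_above x \<longleftrightarrow> (\<exists>b. y = Up b \<and> x = Lo b)"
  by (cases x; cases y) auto

text \<open>Composing with a lower partition in which the strands leaving \<open>B\<close> are
  pairwise independent merely replaces each lower point of \<open>B\<close> by the lower points
  that hang from it. All compositions below are arranged so that this case suffices.\<close>

lemma compose_block:
  assumes p: "partition_on (points k l) p" and q: "partition_on (points l m) q"
    and B: "B \<in> p"
    and N: "\<And>b. Lo b \<in> B \<Longrightarrow> N b \<in> q"
    and Nu: "\<And>b b'. Lo b \<in> B \<Longrightarrow> Up b' \<in> N b \<longleftrightarrow> b' = b"
    and ne: "Up a \<in> B \<or> Lo j \<in> B \<and> Lo a \<in> N j"
  shows "{x. (\<exists>a. x = Up a \<and> Up a \<in> B) \<or> (\<exists>a b. x = Lo a \<and> Lo b \<in> B \<and> Lo a \<in> N b)}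
           \<in> compose_partition p q"
proof -
  let ?F = "(\<lambda>B. glue_above ` B) ` p \<union> (\<lambda>B. glue_below ` B) ` q"
  let ?K = "glue_above ` B \<union> (\<Union>b\<in>{b. Lo b \<in> B}. glue_below ` N b)"
  have dp: "X = Y" if "X \<in> p" "Y \<in> p" "x \<in> X" "x \<in> Y" for X Y x
    using partition_onD2[OF p] that by (auto simp: disjoint_def)
  have dq: "X = Y" if "X \<in> q" "Y \<in> q" "x \<in> X" "x \<in> Y" for X Y x
    using partition_onD2[OF q] that by (auto simp: disjoint_def)
  have Bne: "B \<noteq> {}" using partition_onD3[OF p] B by auto
  have gen: "?K \<in> generated_classes ?F"
  proof (rule generated_classesI[where ?B0.0 = "glue_above ` B"])
    show "?K \<noteq> {}" using Bne by auto
    show "?K \<subseteq> \<Union>?F"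
    proof (intro Un_least UN_least)
      show "glue_above ` B \<subseteq> \<Union>?F" using B by blast
    next
      fix b assume "b \<in> {b. Lo b \<in> B}"
      then have "glue_below ` N b \<in> ?F" using N by blast
      then show "glue_below ` N b \<subseteq> \<Union>?F" by blast
    qed
    show "glue_above ` B \<in> ?F" "glue_above ` B \<noteq> {}" "glue_above ` B \<subseteq> ?K"
      using B Bne by auto
  next
    fix X assume X: "X \<in> ?F" "X \<inter> ?K \<noteq> {}"
    from X(1) show "X \<subseteq> ?K"
    proof
      assume "X \<in> (\<lambda>B. glue_above ` B) ` p"
      then obtain Y where Y: "Y \<in> p" "X = glue_above ` Y" by (rule imageE)
      obtain x where "x \<in> Y" "x \<in> B"
      proof -
        obtain z where z: "z \<in> glue_above ` Y" "z \<in> ?K" using X(2) unfolding Y(2) by (meson disjoint_iff)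
        from z(1) obtain x where "z = glue_above x" "x \<in> Y" by (rule imageE)
        with z(2) have x: "x \<in> Y" "glue_above x \<in> ?K" by simp_all
        from x(2) show ?thesis
        proof
          assume "glue_above x \<in> glue_above ` B"
          then show ?thesis using x(1) inj_glue_above that by (auto simp: inj_eq)
        next
          assume "glue_above x \<in> (\<Union>b\<in>{b. Lo b \<in> B}. glue_below ` N b)"
          then obtain b y where b: "Lo b \<in> B" "y \<in> N b" "glue_below y = glue_above x" by auto
          then obtain b' where "y = Up b'" "x = Lo b'" by (auto simp: glue_below_eq_above_iff)
          then have "x = Lo b" using Nu[OF b(1)] b(2) by simp
          then show ?thesis using x(1) b(1) that by auto
        qed
      qed
      then have "Y = B" using dp Y(1) B by metis
      then show ?thesis using Y by auto
    next
      assume "X \<in> (\<lambda>B. glue_below ` B) ` q"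
      then obtain Y where Y: "Y \<in> q" "X = glue_below ` Y" by (rule imageE)
      obtain x b where "Lo b \<in> B" "x \<in> Y" "x \<in> N b"
      proof -
        obtain z where z: "z \<in> glue_below ` Y" "z \<in> ?K" using X(2) unfolding Y(2) by (meson disjoint_iff)
        from z(1) obtain y where "z = glue_below y" "y \<in> Y" by (rule imageE)
        with z(2) have y: "y \<in> Y" "glue_below y \<in> ?K" by simp_all
        from y(2) show ?thesis
        proof
          assume "glue_below y \<in> glue_above ` B"
          then obtain b where "y = Up b" "Lo b \<in> B" by (auto simp: glue_below_eq_above_iff)
          then show ?thesis using y(1) Nu that by blast
        next
          assume "glue_below y \<in> (\<Union>b\<in>{b. Lo b \<in> B}. glue_below ` N b)"
          then show ?thesis using y(1) inj_glue_below that by (auto simp: inj_eq)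
        qed
      qed
      then have "Lo b \<in> B" "Y = N b" using dq[OF Y(1) N] by auto
      then show ?thesis using Y by auto
    qed
  next
    fix y assume "y \<in> ?K"
    then show "\<exists>X\<in>?F. y \<in> X \<and> (X = glue_above ` B \<or> X \<inter> glue_above ` B \<noteq> {})"
    proof
      assume "y \<in> glue_above ` B"
      then show ?thesis using B by blast
    next
      assume "y \<in> (\<Union>b\<in>{b. Lo b \<in> B}. glue_below ` N b)"
      then obtain b where b: "Lo b \<in> B" "y \<in> glue_below ` N b" by auto
      have "Mid b \<in> glue_below ` N b" using Nu[OF b(1), of b] by (metis glue_below.simps(1) image_eqI)
      moreover have "Mid b \<in> glue_above ` B" using b(1) by (metis glue_above.simps(2) image_eqI)
      ultimately have meet: "glue_below ` N b \<inter> glue_above ` B \<noteq> {}" by blast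
      have mem: "glue_below ` N b \<in> ?F" by (intro UnI2 imageI N b(1))
      show ?thesis by (rule bexI[where x = "glue_below ` N b", OF _ mem], intro conjI disjI2 b(2) meet)
    qed
  qed
  have vim: "outer_point -` ?K =
    {x. (\<exists>a. x = Up a \<and> Up a \<in> B) \<or> (\<exists>a b. x = Lo a \<and> Lo b \<in> B \<and> Lo a \<in> N b)}" (is "_ = ?Z")
  proof (rule Set.set_eqI)
    fix x
    have nb: "Bot a \<noteq> glue_above y" "Top a \<noteq> glue_below y" for a y by (cases y; simp)+
    have 1: "Top a \<in> glue_above ` X \<longleftrightarrow> Up a \<in> X" "Bot a \<notin> glue_above ` X" 
      "Bot a \<in> glue_below ` X \<longleftrightarrow> Lo a \<in> X" "Top a \<notin> glue_below ` X" for a X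
      using inj_image_mem_iff[OF inj_glue_above, of "Up a" X]
        inj_image_mem_iff[OF inj_glue_below, of "Lo a" X] nb by auto
    show "x \<in> outer_point -` ?K \<longleftrightarrow> x \<in> ?Z" by (cases x) (simp_all add: 1 del: image_iff)
  qed
  have "?Z \<in> (\<lambda>K. outer_point -` K) ` generated_classes ?F"
    using imageI[OF gen, of "\<lambda>K. outer_point -` K"] unfolding vim .
  moreover have "?Z \<notin> {{}}" using ne by auto
  ultimately show ?thesis unfolding compose_partition_def by (rule DiffI)
qed


fun opposite :: "color \<Rightarrow> color" where
  "opposite White = Black"
| "opposite Black = White"

definition identity_partition :: "nat \<Rightarrow> point set set" where
  "identity_partition m = (\<lambda>a. {Up a, Lo a}) ` {1..m}"

lemma tensor_left: "B \<in> p \<Longrightarrow> B \<in> tensor_partition k l p q"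
  by (simp add: tensor_partition_def)

lemma tensor_right: "B \<in> q \<Longrightarrow> shift_point k l ` B \<in> tensor_partition k l p q"
  by (simp add: tensor_partition_def)

context
  fixes C :: "tcp set"
  assumes category: "partition_category C"
begin

lemma in_category_partition:
  "(c, d, p) \<in> C \<Longrightarrow> partition_on (points (length c) (length d)) p"
  using category unfolding partition_category_def two_colored_partitions_def by auto

lemma category_adjoint: "(c, d, p) \<in> C \<Longrightarrow> (d, c, adjoint_partition p) \<in> C"
  using category unfolding partition_category_def by blast

lemma category_tensor:
  "(c1, d1, p1) \<in> C \<Longrightarrow> (c2, d2, p2) \<in> C \<Longrightarrow>
     (c1 @ c2, d1 @ d2, tensor_partition (length c1) (length d1) p1 p2) \<in> C"
  using category unfolding partition_category_def by blast

lemma category_compose: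
  "(c, d, p) \<in> C \<Longrightarrow> (d, e, q) \<in> C \<Longrightarrow> (c, e, compose_partition p q) \<in> C"
  using category unfolding partition_category_def by blast

lemma category_strand: "([x], [x], {{Up 1, Lo 1}}) \<in> C"
  using category unfolding partition_category_def by (cases x) simp_all

lemma category_cup: "([], [opposite x, x], {{Lo 1, Lo 2}}) \<in> C"
  using category unfolding partition_category_def by (cases x) simp_all

text \<open>The empty identity is the composition of a cup with a cap, whatever that composition
  is, since the empty set has only one partition.\<close>

lemma category_identity: "(w, w, identity_partition (length w)) \<in> C"
proof (induction w rule: rev_induct)
  case Nil
  have "([], [White, Black], {{Lo 1, Lo 2}}) \<in> C" "([White, Black], [], {{Up 1, Up 2}}) \<in> C"
    using category unfolding partition_category_def by simp_all
  then have *: "([], [], compose_partition {{Lo 1, Lo 2}} {{Up 1, Up 2}}) \<in> C"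
    by (rule category_compose)
  from in_category_partition[OF this]
  have "compose_partition {{Lo 1, Lo 2}} {{Up 1, Up 2}} = {}"
    by (simp add: points_def partition_on_empty)
  with * show ?case by (simp add: identity_partition_def)
next
  case (snoc x w)
  have "tensor_partition (length w) (length w) (identity_partition (length w)) {{Up 1, Lo 1}}
      = identity_partition (length (w @ [x]))"
    by (auto simp: tensor_partition_def identity_partition_def atLeastAtMostSuc_conv)
  then show ?case using category_tensor[OF snoc category_strand[of x]] by simp
qed

lemma insert_cup:
  assumes "([], w1 @ w2, r) \<in> C"
  shows "\<exists>r'. ([], w1 @ [opposite x, x] @ w2, r') \<in> C"
proof -
  have "(w1 @ [], w1 @ [opposite x, x],
      tensor_partition (length w1) (length w1) (identity_partition (length w1)) {{Lo 1, Lo 2}}) \<in> C"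
    by (rule category_tensor[OF category_identity category_cup])
  from category_tensor[OF this category_identity[of w2]]
  obtain r' where "(w1 @ w2, w1 @ [opposite x, x] @ w2, r') \<in> C" by auto
  then show ?thesis using category_compose[OF assms] by blast
qed

text \<open>Only the existence of some partition with the given lower coloring matters here, which
  saves all computations with nested pairs.\<close>

lemma cups_before: "\<exists>w' r. ([], w' @ w, r) \<in> C"
proof (induction w)
  case Nil
  show ?case using category_identity[of "[]"] by auto
next
  case (Cons x w)
  then obtain w' r where "([], w' @ w, r) \<in> C" by auto
  from insert_cup[OF this, of x] obtain r' where "([], (w' @ [opposite x]) @ x # w, r') \<in> C" by auto
  then show ?case by blast
qed

lemma opposite_opposite [simp]: "opposite (opposite x) = x"
  by (cases x) simp_all

lemma cups_after: "\<exists>w' r. ([], w @ w', r) \<in> C"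
proof (induction w rule: rev_induct)
  case Nil
  show ?case using category_identity[of "[]"] by auto
next
  case (snoc x w)
  then obtain w' r where "([], w @ w', r) \<in> C" by auto
  from insert_cup[OF this, of "opposite x"]
  obtain r' where "([], (w @ [x]) @ (opposite x # w'), r') \<in> C" by auto
  then show ?case by blast
qed

text \<open>Composing with such a partition erases one lower point of color \<open>x\<close> from
  a partition placed above it.\<close>

definition capping :: "color \<Rightarrow> bool" where
  "capping x \<longleftrightarrow> (\<exists>e q. ([x], e, q) \<in> C \<and> {Up 1} \<in> q)"

lemma split_at: "1 \<le> a \<Longrightarrow> a \<le> length c \<Longrightarrow>
    \<exists>c1 c2. c = c1 @ [c ! (a - 1)] @ c2 \<and> length c1 = a - 1"
  using id_take_nth_drop[of "a - 1" c] by (intro exI[of _ "take (a - 1) c"] exI[of _ "drop a c"]) auto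

text \<open>All upper points but \<open>a\<close> are bent downwards by cups on both sides, while
  a single strand keeps \<open>a\<close> in place.\<close>

lemma capping_of_upper_singleton:
  assumes q: "(c, d, q) \<in> C" and sing: "{Up a} \<in> q"
  shows "capping (c ! (a - 1))"
proof -
  let ?x = "c ! (a - 1)"
  have "Up a \<in> points (length c) (length d)"
    using partition_onD1[OF in_category_partition[OF q]] sing by auto
  then have a: "1 \<le> a" "a \<le> length c" by (auto simp: points_def)
  obtain c1 c2 where c: "c = c1 @ [?x] @ c2" "length c1 = a - 1" using split_at[OF a] by blast
  obtain w' r1 where r1: "([], w' @ c1, r1) \<in> C" using cups_before by blast
  obtain w'' r2 where r2: "([], c2 @ w'', r2) \<in> C" using cups_after by blast
  define s where "s = length w' + a"
  define top where "top = tensor_partition 1 s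
      (tensor_partition 0 (length (w' @ c1)) r1 {{Up 1, Lo 1}}) r2"
  define bot where "bot = tensor_partition (length w' + length c) (length w' + length d)
      (tensor_partition (length w') (length w') (identity_partition (length w')) q)
      (identity_partition (length w''))"
  have s: "s = Suc (length (w' @ c1))" using a c by (simp add: s_def)
  have "([?x], (w' @ c1) @ [?x], tensor_partition 0 (length (w' @ c1)) r1 {{Up 1, Lo 1}}) \<in> C"
    using category_tensor[OF r1 category_strand[of ?x]] by simp
  from category_tensor[OF this r2]
  have "([?x], ((w' @ c1) @ [?x]) @ c2 @ w'', top) \<in> C" by (simp add: top_def s)
  moreover have "((w' @ c1) @ [?x]) @ c2 @ w'' = w' @ c @ w''"
    using arg_cong[OF c(1), of "\<lambda>c. w' @ c @ w''"] by simp
  ultimately have top: "([?x], w' @ c @ w'', top) \<in> C" by (simp only:)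
  have bot: "(w' @ c @ w'', w' @ d @ w'', bot) \<in> C"
    using category_tensor[OF category_tensor[OF category_identity[of w'] q] category_identity[of w'']]
    by (simp add: bot_def)
  have "shift_point 0 (length (w' @ c1)) ` {Up 1, Lo 1} \<in> top"
    unfolding top_def by (intro tensor_left tensor_right) simp
  then have B: "{Up 1, Lo s} \<in> top" by (simp add: s)
  have "shift_point (length w') (length w') ` {Up a} \<in> bot"
    unfolding bot_def by (intro tensor_left tensor_right sing)
  then have N: "{Up s} \<in> bot" by (simp add: s_def)
  let ?Z = "{x. (\<exists>a. x = Up a \<and> Up a \<in> {Up 1, Lo s}) \<or>
     (\<exists>a b. x = Lo a \<and> Lo b \<in> {Up 1, Lo s} \<and> Lo a \<in> {Up s})}"
  have "?Z \<in> compose_partition top bot"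
    by (rule compose_block[OF in_category_partition[OF top] in_category_partition[OF bot] B,
          where N = "\<lambda>_. {Up s}" and a = 1]) (use N in auto)
  moreover have "?Z = {Up 1}" by auto
  ultimately show ?thesis unfolding capping_def using category_compose[OF top bot] by auto
qed

text \<open>Composing a cup with the given partition on one of its two legs isolates the other
  leg, which has the opposite color.\<close>

lemma capping_opposite:
  assumes "capping x"
  shows "capping (opposite x)"
proof -
  obtain e q where q: "([x], e, q) \<in> C" "{Up 1} \<in> q" using assms by (auto simp: capping_def)
  define bot where "bot = tensor_partition 1 1 {{Up 1, Lo 1}} q"
  have bot: "([opposite x, x], opposite x # e, bot) \<in> C"
    using category_tensor[OF category_strand[of "opposite x"] q(1)] by (simp add: bot_def)
  have N1: "{Up 1, Lo 1} \<in> bot" unfolding bot_def by (intro tensor_left) simp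
  have "shift_point 1 1 ` {Up 1} \<in> bot" unfolding bot_def by (intro tensor_right q(2))
  then have N2: "{Up 2} \<in> bot" by (simp add: numeral_2_eq_2)
  let ?N = "\<lambda>b::nat. if b = 1 then {Up 1, Lo 1} else {Up 2}"
  let ?Z = "{x. (\<exists>a. x = Up a \<and> Up a \<in> {Lo 1, Lo 2}) \<or>
     (\<exists>a b. x = Lo a \<and> Lo b \<in> {Lo 1, Lo 2} \<and> Lo a \<in> ?N b)}"
  have "?Z \<in> compose_partition {{Lo 1, Lo 2}} bot"
    by (rule compose_block[OF in_category_partition[OF category_cup[of x]] in_category_partition[OF bot],
          where j = 1 and a = 1]) (use N1 N2 in auto)
  moreover have "?Z = {Lo 1}" by (auto split: if_splits)
  ultimately have "{Lo 1} \<in> compose_partition {{Lo 1, Lo 2}} bot" by simp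
  then have "flip_point ` {Lo 1} \<in> adjoint_partition (compose_partition {{Lo 1, Lo 2}} bot)"
    unfolding adjoint_partition_def by blast
  then have "{Up 1} \<in> adjoint_partition (compose_partition {{Lo 1, Lo 2}} bot)" by simp
  from capping_of_upper_singleton[OF category_adjoint[OF category_compose[OF category_cup bot]] this]
  show ?thesis by simp
qed

lemma capping_of_singleton:
  assumes q: "(c, d, q) \<in> C" and sing: "{P} \<in> q"
  shows "capping x"
proof -
  have "\<exists>y. capping y"
  proof (cases P)
    case (Up a)
    then show ?thesis using capping_of_upper_singleton[OF q] sing by blast
  next
    case (Lo a)
    have "flip_point ` {P} \<in> adjoint_partition q" unfolding adjoint_partition_def using sing by blast
    then have "{Up a} \<in> adjoint_partition q" using Lo by simp
    then show ?thesis using capping_of_upper_singleton[OF category_adjoint[OF q]] by blast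
  qed
  then obtain y where "capping y" ..
  moreover have "x = y \<or> x = opposite y" by (cases x; cases y) simp_all
  ultimately show ?thesis using capping_opposite by auto
qed

text \<open>The erasing partition is placed below \<open>s\<close> and identity strands below all
  other lower points, so that \<open>B\<close> loses precisely the point \<open>s\<close>.\<close>

lemma cap_lower_point:
  assumes p: "(c, d, p) \<in> C" and B: "B \<in> p" "Lo s \<in> B" "card B \<ge> 2"
    and cap: "\<And>x. capping x"
  shows "\<exists>d' p'. (c, d', p') \<in> C \<and> (\<exists>B'\<in>p'. card B' = card B - 1)"
proof -
  have pts: "B \<subseteq> points (length c) (length d)"
    using partition_onD1[OF in_category_partition[OF p]] B by auto
  then have finB: "finite B" by (rule finite_subset) (simp add: points_def)
  from pts B have s: "1 \<le> s" "s \<le> length d" by (auto simp: points_def)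
  obtain d1 d2 where d: "d = d1 @ [d ! (s - 1)] @ d2" "length d1 = s - 1"
    using split_at[OF s] by blast
  obtain e q where q: "([d ! (s - 1)], e, q) \<in> C" "{Up 1} \<in> q"
    using cap unfolding capping_def by blast
  define M where "M = tensor_partition s (s - 1 + length e)
     (tensor_partition (s - 1) (s - 1) (identity_partition (s - 1)) q)
     (identity_partition (length d2))"
  have "(d1 @ [d ! (s - 1)] @ d2, d1 @ e @ d2, M) \<in> C"
    using category_tensor[OF category_tensor[OF category_identity[of d1] q(1)] category_identity[of d2]] s d
    by (simp add: M_def)
  then have M: "(d, d1 @ e @ d2, M) \<in> C" using d by simp
  define N where "N b = (if b < s then {Up b, Lo b} else if b = s then {Up s}
     else {Up b, Lo (b - 1 + length e)})" for b
  have len: "length d = s + length d2" using s by (subst d(1)) (simp add: d(2))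
  have NM: "N b \<in> M" if "Lo b \<in> B" for b
  proof -
    have b: "1 \<le> b" "b \<le> length d" using that pts by (auto simp: points_def)
    consider "b < s" | "b = s" | "b > s" by linarith
    then show ?thesis
    proof cases
      case 1
      then have "{Up b, Lo b} \<in> identity_partition (s - 1)"
        using b by (auto simp: identity_partition_def)
      then show ?thesis using 1 unfolding N_def M_def by (auto intro: tensor_left)
    next
      case 2
      have "shift_point (s - 1) (s - 1) ` {Up 1} \<in> M"
        unfolding M_def by (intro tensor_left tensor_right q(2))
      then show ?thesis using 2 s by (simp add: N_def)
    next
      case 3
      then have "{Up (b - s), Lo (b - s)} \<in> identity_partition (length d2)"
        using b len unfolding identity_partition_def by (intro image_eqI[where x = "b - s"]) auto
      then have "shift_point s (s - 1 + length e) ` {Up (b - s), Lo (b - s)} \<in> M"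
        unfolding M_def by (rule tensor_right)
      moreover have "s - 1 + length e + (b - s) = b - 1 + length e" using 3 s by simp
      ultimately show ?thesis using 3 s by (simp add: N_def)
    qed
  qed
  have Nu: "Up b' \<in> N b \<longleftrightarrow> b' = b" for b b' by (auto simp: N_def)
  let ?Z = "{x. (\<exists>a. x = Up a \<and> Up a \<in> B) \<or> (\<exists>a b. x = Lo a \<and> Lo b \<in> B \<and> Lo a \<in> N b)}"
  \<comment> \<open>\<open>g\<close> renumbers the lower points to the right of \<open>s\<close>, as \<open>s\<close> is replaced by the coloring \<open>e\<close>.\<close>
  define g where "g P = (case P of Up a \<Rightarrow> Up a | Lo b \<Rightarrow> if b < s then Lo b else Lo (b - 1 + length e))" for P
  have Z: "?Z = g ` (B - {Lo s})" (is "_ = ?R")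
  proof (intro equalityI subsetI)
    fix x assume "x \<in> ?Z"
    then consider a where "x = Up a" "Up a \<in> B" | a b where "x = Lo a" "Lo b \<in> B" "Lo a \<in> N b" by auto
    then show "x \<in> ?R"
    proof cases
      case 1
      then show ?thesis by (intro image_eqI[where x = "Up a"]) (auto simp: g_def)
    next
      case 2
      then show ?thesis by (intro image_eqI[where x = "Lo b"]) (auto simp: g_def N_def split: if_splits)
    qed
  next
    fix x assume "x \<in> ?R"
    then obtain P where "x = g P" "P \<in> B" "P \<noteq> Lo s" by auto
    then show "x \<in> ?Z"
      by (cases P) (auto simp: g_def N_def intro!: exI)
  qed
  have inj: "inj_on g (B - {Lo s})"
  proof (rule inj_onI)
    fix P Q assume PQ: "P \<in> B - {Lo s}" "Q \<in> B - {Lo s}" "g P = g Q"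
    show "P = Q" by (cases P; cases Q) (use PQ s in \<open>auto simp: g_def split: if_splits\<close>)
  qed
  have card: "card ?Z = card B - 1" unfolding Z card_image[OF inj] using finB B by simp
  have "?Z \<noteq> {}"
  proof
    assume "?Z = {}"
    then have "card ?Z = 0" by (metis card.empty)
    then show False using card B(3) by linarith
  qed
  then obtain a b where "Up a \<in> B \<or> Lo b \<in> B \<and> Lo a \<in> N b" by blast
  then have "?Z \<in> compose_partition p M"
    using NM Nu
    by (intro compose_block[OF in_category_partition[OF p] in_category_partition[OF M] B(1)])
  then show ?thesis using category_compose[OF p M] card by blast
qed

lemma property3_even_block:
  assumes p3: "property3 C" and p: "(c, d, p) \<in> C" and B: "B \<in> p" "card B \<ge> 2"
  shows "even (card B)"
proof -
  let ?w = "white_lower_black_upper c d" and ?b = "black_lower_white_upper c d"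
  have pts: "B \<subseteq> points (length c) (length d)"
    using partition_onD1[OF in_category_partition[OF p]] B by auto
  then have fin: "finite B" by (rule finite_subset) (simp add: points_def)
  have x: "x = White \<or> x = Black" for x by (cases x) auto
  have "B = (B \<inter> ?w) \<union> (B \<inter> ?b)"
    using pts x by (force simp: points_def white_lower_black_upper_def black_lower_white_upper_def)
  moreover have "(B \<inter> ?w) \<inter> (B \<inter> ?b) = {}"
    by (auto simp: white_lower_black_upper_def black_lower_white_upper_def)
  ultimately have "card B = card (B \<inter> ?w) + card (B \<inter> ?b)"
    using fin by (metis card_Un_disjoint finite_Int)
  moreover have "card (B \<inter> ?w) = card (B \<inter> ?b)"
    using p3 p B unfolding property3_def by blast
  ultimately show ?thesis by simp
qed

text \<open>This is why no further combination of the properties occurs. A singleton allows to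
  erase a point from a block with at least three points, and under property 3 neither the old nor
  the new block may have an odd number of points.\<close>

lemma property_2_of_not_1_and_3:
  assumes "\<not> property1 C" "property3 C"
  shows "property2 C"
proof (rule ccontr)
  assume "\<not> property2 C"
  then obtain c d q B where q: "(c, d, q) \<in> C" "B \<in> q" "card B < 2"
    unfolding property2_def by force
  have "B \<noteq> {}" using partition_onD3[OF in_category_partition[OF q(1)]] q(2) by auto
  moreover have "finite B"
    using partition_onD1[OF in_category_partition[OF q(1)]] q(2)
    by (metis Union_upper finite_Un finite_atLeastAtMost finite_imageI finite_subset points_def)
  ultimately have "card B = 1" using q(3) by (metis One_nat_def card_0_eq less_2_cases)
  then obtain P where "B = {P}" by (auto simp: card_1_singleton_iff)
  then have cap: "capping x" for x using capping_of_singleton q by blast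
  have key: False if p: "(c, d, p) \<in> C" "B \<in> p" "card B \<ge> 3" "Lo s \<in> B" for c d p B s
  proof -
    obtain d' p' B' where "(c, d', p') \<in> C" "B' \<in> p'" "card B' = card B - 1"
      using cap_lower_point[OF p(1,2,4) _ cap] p(3) by auto
    then have "even (card B - 1)" using property3_even_block[OF assms(2)] p(3) by fastforce
    moreover have "even (card B)" using property3_even_block[OF assms(2) p(1,2)] p(3) by simp
    ultimately show False using p(3) by auto
  qed
  obtain c d p B where p: "(c, d, p) \<in> C" "B \<in> p" "card B \<ge> 3"
    using assms(1) unfolding property1_def by force
  then have "B \<noteq> {}" by auto
  then obtain P where P: "P \<in> B" by auto
  show False
  proof (cases P)
    case (Lo s)
    then show False using key p P by blast
  next
    case (Up s)
    have "flip_point ` B \<in> adjoint_partition p" unfolding adjoint_partition_def using p(2) by blast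
    moreover have "inj flip_point" by (rule injI) (metis flip_point.elims point.inject point.distinct(1))
    then have "card (flip_point ` B) = card B" by (simp add: card_image inj_on_subset)
    moreover have "Lo s \<in> flip_point ` B" using P Up by force
    ultimately show False using key[OF category_adjoint[OF p(1)]] p(3) by metis
  qed
qed

end

section \<open>The linear equations of a partition\<close>

definition constant_on_blocks :: "'a set set \<Rightarrow> ('a \<Rightarrow> 'n) \<Rightarrow> bool" where
  "constant_on_blocks p f \<longleftrightarrow> (\<forall>B\<in>p. \<forall>x\<in>B. \<forall>y\<in>B. f x = f y)"

text \<open>For white lower points this is the entry in which the derivation replaces an index
  \<open>a\<close> by \<open>x\<close>. The matrix of the black generators is minus the transpose,
  and upper points contribute with a minus sign because they stem from the subtracted sum in a
  relation; the two effects cancel for black upper points.\<close>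

definition weight :: "complex^'n^'n \<Rightarrow> 'a set \<Rightarrow> 'a \<Rightarrow> 'n \<Rightarrow> 'n \<Rightarrow> complex" where
  "weight v pos P a x = (if P \<in> pos then v $ a $ x else - v $ x $ a)"

text \<open>The value of the derivation with matrix \<open>v\<close> on the relation of
  \<open>p\<close> indexed by \<open>f\<close>, in a form that does not distinguish upper and
  lower points: as the counit kills all words with an off-diagonal letter, the indices can differ
  from \<open>f\<close> at one point only.\<close>

definition defect :: "complex^'n^'n \<Rightarrow> 'a set \<Rightarrow> 'a set \<Rightarrow> 'a set set \<Rightarrow> ('a \<Rightarrow> 'n::finite) \<Rightarrow> complex" where
  "defect v X pos p f =
     (\<Sum>P\<in>X. \<Sum>x\<in>UNIV. of_bool (constant_on_blocks p (f(P := x))) * weight v pos P (f P) x)"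

text \<open>In this language property 3 says that all blocks with at least two points have charge zero, and
  property 4 that all partitions do.\<close>

definition charge :: "'a set \<Rightarrow> 'a set \<Rightarrow> complex" where
  "charge pos B = (\<Sum>P\<in>B. if P \<in> pos then 1 else - 1)"

text \<open>The contribution of \<open>B\<close> to the defect of a labelling that takes the value
  \<open>a\<close> on \<open>B\<close>. Only a singleton can be relabelled without leaving the
  labellings that are constant on blocks, whence the row and column sums.\<close>

definition block_sum :: "complex^'n^'n \<Rightarrow> 'a set \<Rightarrow> 'a set \<Rightarrow> 'n::finite \<Rightarrow> complex" where
  "block_sum v pos B a =
     (\<Sum>P\<in>B. if card B = 1 then \<Sum>x\<in>UNIV. weight v pos P a x else weight v pos P a a)"

context
  fixes X :: "'a set" and p :: "'a set set" and pos :: "'a set"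
  assumes part: "partition_on X p" and fin: "finite X"
begin

lemma finite_block: "B \<in> p \<Longrightarrow> finite B"
  using partition_onD1[OF part] fin by (auto intro: finite_subset)

lemma block_unique: "B \<in> p \<Longrightarrow> B' \<in> p \<Longrightarrow> P \<in> B \<Longrightarrow> P \<in> B' \<Longrightarrow> B' = B"
  using partition_onD2[OF part] by (auto simp: disjoint_def)

lemma sum_over_blocks: "(\<Sum>P\<in>X. g P) = (\<Sum>B\<in>p. \<Sum>P\<in>B. g P)"
proof -
  have "(\<Sum>P\<in>\<Union>p. g P) = (sum \<circ> sum) g p"
    by (rule sum.Union_disjoint) (use finite_block block_unique in auto)
  then show ?thesis using partition_onD1[OF part] by simp
qed

lemma constant_after_change:
  assumes f: "constant_on_blocks p f" and B: "B \<in> p" "P \<in> B"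
  shows "constant_on_blocks p (f(P := x)) \<longleftrightarrow> card B = 1 \<or> x = f P"
proof
  assume c: "constant_on_blocks p (f(P := x))"
  show "card B = 1 \<or> x = f P"
  proof (cases "B = {P}")
    case False
    then obtain Q where Q: "Q \<in> B" "Q \<noteq> P" using B by auto
    have "(f(P := x)) P = (f(P := x)) Q" using c B Q unfolding constant_on_blocks_def by blast
    moreover have "f P = f Q" using f B Q unfolding constant_on_blocks_def by blast
    ultimately show ?thesis using Q by simp
  qed simp
next
  assume "card B = 1 \<or> x = f P"
  then show "constant_on_blocks p (f(P := x))"
  proof
    assume "card B = 1"
    then have BP: "B = {P}" using B by (auto simp: card_1_singleton_iff)
    show ?thesis unfolding constant_on_blocks_def
    proof (intro ballI)
      fix B' y z assume B': "B' \<in> p" "y \<in> B'" "z \<in> B'"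
      show "(f(P := x)) y = (f(P := x)) z"
      proof (cases "B' = B")
        case False
        then have "y \<noteq> P" "z \<noteq> P" using block_unique B B' by auto
        moreover have "f y = f z" using f B' unfolding constant_on_blocks_def by blast
        ultimately show ?thesis by simp
      qed (use B' BP in simp)
    qed
  qed (use f in simp)
qed

lemma defect_constant:
  assumes f: "constant_on_blocks p f" and h: "\<And>B P. B \<in> p \<Longrightarrow> P \<in> B \<Longrightarrow> f P = h B"
  shows "defect v X pos p f = (\<Sum>B\<in>p. block_sum v pos B (h B))"
  unfolding defect_def sum_over_blocks block_sum_def
proof (intro sum.cong refl)
  fix B P assume B: "B \<in> p" "P \<in> B"
  show "(\<Sum>x\<in>UNIV. of_bool (constant_on_blocks p (f(P := x))) * weight v pos P (f P) x) =
    (if card B = 1 then \<Sum>x\<in>UNIV. weight v pos P (h B) x else weight v pos P (h B) (h B))"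
    unfolding constant_after_change[OF f B] h[OF B]
    by (simp add: of_bool_def if_distrib[of "\<lambda>c. c * _"] sum.delta' cong: if_cong)
qed

text \<open>Starting from a labelling with one exceptional point in \<open>B\<close>, the only
  changes that make it constant on \<open>B\<close> are to correct the exceptional point or, if
  \<open>B\<close> is a pair, to change the other point.\<close>

lemma defect_one_point:
  assumes B: "B \<in> p" "P0 \<in> B" "card B \<ge> 2" and ab: "a \<noteq> b"
  shows "defect v X pos p (\<lambda>P. if P = P0 then a else b) =
    weight v pos P0 a b + (\<Sum>Q\<in>B - {P0}. if B = {P0, Q} then weight v pos Q b a else 0)"
proof -
  let ?f = "\<lambda>P. if P = P0 then a else b"
  let ?c = "\<lambda>P x. constant_on_blocks p (?f(P := x))"
  obtain R where R: "R \<in> B" "R \<noteq> P0"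
    using B(2,3) by (metis One_nat_def Suc_1 card.empty card.insert empty_iff finite.emptyI
        insertI1 not_less_eq_eq order_refl subsetI subset_singletonD subset_antisym singletonD)
  have out: "\<not> ?c P x" if "P \<notin> B" for P x
  proof
    assume "?c P x"
    then have "(?f(P := x)) P0 = (?f(P := x)) R" using B(1,2) R unfolding constant_on_blocks_def by blast
    then show False using that B(2) R ab by (auto split: if_splits)
  qed
  have at_P0: "?c P0 x \<longleftrightarrow> x = b" for x
  proof
    assume "?c P0 x"
    then have "(?f(P0 := x)) P0 = (?f(P0 := x)) R" using B(1,2) R unfolding constant_on_blocks_def by blast
    then show "x = b" using R by simp
  next
    assume "x = b"
    then have "?f(P0 := x) = (\<lambda>_. b)" by auto
    then show "?c P0 x" by (simp add: constant_on_blocks_def)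
  qed
  have other: "?c Q x \<longleftrightarrow> B = {P0, Q} \<and> x = a" if Q: "Q \<in> B" "Q \<noteq> P0" for Q x
  proof
    assume c: "?c Q x"
    then have eq: "(?f(Q := x)) P0 = (?f(Q := x)) S" if "S \<in> B" for S
      using B(1,2) that unfolding constant_on_blocks_def by blast
    have "x = a" using eq[OF Q(1)] Q by simp
    moreover have "S = P0 \<or> S = Q" if "S \<in> B" for S using eq[OF that] Q ab by (auto split: if_splits)
    ultimately show "B = {P0, Q} \<and> x = a" using Q B(2) by auto
  next
    assume *: "B = {P0, Q} \<and> x = a"
    show "?c Q x" unfolding constant_on_blocks_def
    proof (intro ballI)
      fix B' y z assume B': "B' \<in> p" "y \<in> B'" "z \<in> B'"
      show "(?f(Q := x)) y = (?f(Q := x)) z"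
      proof (cases "B' = B")
        case True
        then show ?thesis using B' * by auto
      next
        case False
        then have "y \<notin> B" "z \<notin> B" using block_unique B B' by metis+
        then have "y \<noteq> P0 \<and> y \<noteq> Q" "z \<noteq> P0 \<and> z \<noteq> Q" using B(2) Q by auto
        then show ?thesis by simp
      qed
    qed
  qed
  let ?g = "\<lambda>P. \<Sum>x\<in>UNIV. of_bool (?c P x) * weight v pos P (?f P) x"
  have "defect v X pos p ?f = (\<Sum>P\<in>X. ?g P)" by (simp add: defect_def)
  also have "\<dots> = (\<Sum>P\<in>B. ?g P)"
    by (rule sum.mono_neutral_right) (use fin partition_onD1[OF part] B(1) out in auto)
  also have "\<dots> = ?g P0 + (\<Sum>P\<in>B - {P0}. ?g P)"
    by (rule sum.remove[OF finite_block[OF B(1)] B(2)])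
  also have "?g P0 = weight v pos P0 a b"
    unfolding at_P0 by (simp add: of_bool_def if_distrib[of "\<lambda>c. c * _"] sum.delta' cong: if_cong)
  also have "(\<Sum>P\<in>B - {P0}. ?g P) = (\<Sum>Q\<in>B - {P0}. if B = {P0, Q} then weight v pos Q b a else 0)"
  proof (intro sum.cong refl)
    fix Q assume Q: "Q \<in> B - {P0}"
    then have c: "?c Q x \<longleftrightarrow> B = {P0, Q} \<and> x = a" for x by (intro other) auto
    show "?g Q = (if B = {P0, Q} then weight v pos Q b a else 0)"
      unfolding c using Q
      by (simp add: of_bool_def if_distrib[of "\<lambda>c. c * _"] sum.delta' cong: if_cong)
  qed
  finally show ?thesis .
qed

lemma defect_one_point_large:
  assumes B: "B \<in> p" "P0 \<in> B" "card B \<ge> 3" and ab: "a \<noteq> b"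
  shows "defect v X pos p (\<lambda>P. if P = P0 then a else b) = weight v pos P0 a b"
proof -
  have ne: "B \<noteq> {P0, Q}" for Q
  proof
    assume "B = {P0, Q}"
    then have "card B \<le> 2" by (simp add: card_insert_if)
    then show False using B(3) by simp
  qed
  have "defect v X pos p (\<lambda>P. if P = P0 then a else b) =
    weight v pos P0 a b + (\<Sum>Q\<in>B - {P0}. if B = {P0, Q} then weight v pos Q b a else 0)"
    by (rule defect_one_point) (use assms in auto)
  also have "(\<Sum>Q\<in>B - {P0}. if B = {P0, Q} then weight v pos Q b a else 0) = 0"
    using ne by (intro sum.neutral) auto
  finally show ?thesis by simp
qed

lemma defect_one_point_pair:
  assumes B: "{P, Q} \<in> p" "P \<noteq> Q" and ab: "a \<noteq> b"
  shows "defect v X pos p (\<lambda>R. if R = P then a else b) = weight v pos P a b + weight v pos Q b a"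
proof -
  have "{P, Q} - {P} = {Q}" using B(2) by auto
  moreover have "defect v X pos p (\<lambda>R. if R = P then a else b) =
    weight v pos P a b + (\<Sum>R\<in>{P, Q} - {P}. if {P, Q} = {P, R} then weight v pos R b a else 0)"
    by (rule defect_one_point) (use assms in auto)
  ultimately show ?thesis by simp
qed

lemma defect_nonconstant_diagonal:
  assumes diag: "\<And>a b. a \<noteq> b \<Longrightarrow> v $ a $ b = 0" and f: "\<not> constant_on_blocks p f"
  shows "defect v X pos p f = 0"
  unfolding defect_def
proof (intro sum.neutral ballI)
  fix P x
  show "of_bool (constant_on_blocks p (f(P := x))) * weight v pos P (f P) x = 0"
    by (cases "x = f P") (use f diag in \<open>auto simp: weight_def\<close>)
qed

text \<open>In a pair with two distinct labels exactly two changes restore constancy, one for each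
  point, and they are admissible under the same condition on the remaining blocks.\<close>

lemma defect_nonconstant_pairs:
  assumes pairs: "\<And>B. B \<in> p \<Longrightarrow> card B \<le> 2"
    and cancel: "\<And>P Q a b. {P, Q} \<in> p \<Longrightarrow> P \<noteq> Q \<Longrightarrow> a \<noteq> b \<Longrightarrow>
      weight v pos P a b + weight v pos Q b a = 0"
    and f: "\<not> constant_on_blocks p f"
  shows "defect v X pos p f = 0"
proof -
  obtain B P Q where B: "B \<in> p" "P \<in> B" "Q \<in> B" "f P \<noteq> f Q"
    using f unfolding constant_on_blocks_def by auto
  then have PQ: "P \<noteq> Q" by auto
  have "card B \<le> card {P, Q}" using pairs[OF B(1)] PQ by simp
  then have BPQ: "B = {P, Q}" using card_seteq[OF finite_block[OF B(1)], of "{P, Q}"] B by auto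
  let ?c = "\<lambda>R x. constant_on_blocks p (f(R := x))"
  let ?rest = "constant_on_blocks (p - {B}) f"
  have out: "\<not> ?c R x" if "R \<notin> B" for R x
  proof
    assume "?c R x"
    then have "(f(R := x)) P = (f(R := x)) Q" using B unfolding constant_on_blocks_def by blast
    then show False using that B by (auto split: if_splits)
  qed
  have rest: "constant_on_blocks (p - {B}) (f(R := x)) \<longleftrightarrow> ?rest" if R: "R \<in> B" for R x
  proof -
    have eq: "(f(R := x)) y = f y" if "B' \<in> p - {B}" "y \<in> B'" for B' y
      using block_unique[of B B' R] that R B(1) by auto
    show ?thesis unfolding constant_on_blocks_def
      by (intro ball_cong refl) (simp only: eq)
  qed
  have split: "constant_on_blocks p g \<longleftrightarrow> g P = g Q \<and> constant_on_blocks (p - {B}) g" for g :: "'a \<Rightarrow> 'n"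
  proof -
    have "constant_on_blocks (insert B (p - {B})) g \<longleftrightarrow>
        (\<forall>x\<in>B. \<forall>y\<in>B. g x = g y) \<and> constant_on_blocks (p - {B}) g"
      unfolding constant_on_blocks_def by (rule ball_simps)
    moreover have "(\<forall>x\<in>B. \<forall>y\<in>B. g x = g y) \<longleftrightarrow> g P = g Q" unfolding BPQ by auto
    ultimately show ?thesis using insert_Diff[OF B(1)] by simp
  qed
  have cP: "?c P x \<longleftrightarrow> x = f Q \<and> ?rest" for x
    unfolding split rest[OF B(2)] using PQ by auto
  have cQ: "?c Q x \<longleftrightarrow> x = f P \<and> ?rest" for x
    unfolding split rest[OF B(3)] using PQ by auto
  let ?g = "\<lambda>R. \<Sum>x\<in>UNIV. of_bool (?c R x) * weight v pos R (f R) x"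
  have "defect v X pos p f = (\<Sum>R\<in>X. ?g R)" by (simp add: defect_def)
  also have "\<dots> = (\<Sum>R\<in>B. ?g R)"
    by (rule sum.mono_neutral_right) (use fin partition_onD1[OF part] B(1) out in auto)
  also have "\<dots> = ?g P + ?g Q" using PQ by (simp add: BPQ)
  also have "?g P = of_bool ?rest * weight v pos P (f P) (f Q)"
    unfolding cP by (simp add: of_bool_def if_distrib[of "\<lambda>c. c * _"] sum.delta' cong: if_cong)
  also have "?g Q = of_bool ?rest * weight v pos Q (f Q) (f P)"
    unfolding cQ by (simp add: of_bool_def if_distrib[of "\<lambda>c. c * _"] sum.delta' cong: if_cong)
  finally have "defect v X pos p f =
      of_bool ?rest * (weight v pos P (f P) (f Q) + weight v pos Q (f Q) (f P))"
    by (simp add: distrib_left)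
  then show ?thesis using cancel[of P Q] B(1,4) PQ BPQ by simp
qed

lemma charge_total: "charge pos X = (\<Sum>B\<in>p. charge pos B)"
  unfolding charge_def by (rule sum_over_blocks)

text \<open>For labellings that are constant on blocks the defect is a sum of one function of the
  label for each block, and such a sum vanishes identically only if each summand is
  constant.\<close>

lemma defect_zero_blocks:
  assumes zero: "\<And>f. defect v X pos p f = 0"
  shows "B \<in> p \<Longrightarrow> block_sum v pos B a = block_sum v pos B b"
    and "(\<Sum>B\<in>p. block_sum v pos B a) = 0"
proof -
  have all: "(\<Sum>B\<in>p. block_sum v pos B a) = 0" for a
    using defect_constant[of "\<lambda>_. a" "\<lambda>_. a" v] zero by (simp add: constant_on_blocks_def)
  then show "(\<Sum>B\<in>p. block_sum v pos B a) = 0" .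
  assume B: "B \<in> p"
  let ?f = "\<lambda>P. if P \<in> B then a else b" and ?h = "\<lambda>B'. if B' = B then a else b"
  have h: "?f P = ?h B'" if "B' \<in> p" "P \<in> B'" for B' P
    using block_unique[OF B that(1)] that(2) by auto
  then have "constant_on_blocks p ?f" unfolding constant_on_blocks_def by metis
  from defect_constant[OF this h, where v = v] zero
  have "(\<Sum>B'\<in>p. block_sum v pos B' (?h B')) = 0" by simp
  moreover have finp: "finite p" by (rule finite_elements[OF fin part])
  moreover have "(\<Sum>B'\<in>p. block_sum v pos B' (?h B'))
      = block_sum v pos B a + (\<Sum>B'\<in>p - {B}. block_sum v pos B' b)"
    by (subst sum.remove[OF finp B]) simp
  moreover have "(\<Sum>B'\<in>p. block_sum v pos B' b)
      = block_sum v pos B b + (\<Sum>B'\<in>p - {B}. block_sum v pos B' b)"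
    by (rule sum.remove[OF finp B])
  ultimately have "block_sum v pos B a + (\<Sum>B'\<in>p - {B}. block_sum v pos B' b)
      = block_sum v pos B b + (\<Sum>B'\<in>p - {B}. block_sum v pos B' b)"
    using all[of b] by (simp only:)
  then show "block_sum v pos B a = block_sum v pos B b" by (simp only: add_right_cancel)
qed

lemma defect_zeroI:
  assumes offdiag: "(\<forall>a b. a \<noteq> b \<longrightarrow> v $ a $ b = 0) \<or>
      (\<forall>B\<in>p. card B \<le> 2) \<and> (\<forall>P Q a b. {P, Q} \<in> p \<longrightarrow> P \<noteq> Q \<longrightarrow> a \<noteq> b \<longrightarrow>
        weight v pos P a b + weight v pos Q b a = 0)"
    and block: "\<And>B a. B \<in> p \<Longrightarrow> block_sum v pos B a = charge pos B * z"
    and total: "charge pos X * z = 0"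
  shows "defect v X pos p f = 0"
proof (cases "constant_on_blocks p f")
  case False
  from offdiag show ?thesis
  proof
    assume diag: "\<forall>a b. a \<noteq> b \<longrightarrow> v $ a $ b = 0"
    show ?thesis by (rule defect_nonconstant_diagonal[OF _ False]) (rule diag[rule_format])
  next
    assume pairs: "(\<forall>B\<in>p. card B \<le> 2) \<and> (\<forall>P Q a b. {P, Q} \<in> p \<longrightarrow> P \<noteq> Q \<longrightarrow> a \<noteq> b \<longrightarrow>
        weight v pos P a b + weight v pos Q b a = 0)"
    show ?thesis
      by (rule defect_nonconstant_pairs[OF _ _ False])
        (rule pairs[THEN conjunct1, rule_format] pairs[THEN conjunct2, rule_format]; assumption)+
  qed
next
  case True
  have h: "f P = f (SOME Q. Q \<in> B)" if "B \<in> p" "P \<in> B" for B P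
    using True that someI[of "\<lambda>Q. Q \<in> B" P] unfolding constant_on_blocks_def by blast
  have "defect v X pos p f = (\<Sum>B\<in>p. block_sum v pos B (f (SOME Q. Q \<in> B)))"
    by (rule defect_constant[OF True h])
  also have "\<dots> = (\<Sum>B\<in>p. charge pos B * z)" by (intro sum.cong refl block)
  also have "\<dots> = charge pos X * z" by (simp add: charge_total sum_distrib_right)
  finally show ?thesis using total by simp
qed

end


text \<open>The matrices of the derivations that respect all relations; the cohomology turns out
  to be this space.\<close>

definition solutions :: "tcp set \<Rightarrow> (complex^'n^'n) set" where
  "solutions C = {v. \<forall>c d p f. (c, d, p) \<in> C \<longrightarrow>
     defect v (points (length c) (length d)) (white_lower_black_upper c d) p f = 0}"

definition off_diagonal_zero :: "complex^'n^'n \<Rightarrow> bool" where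
  "off_diagonal_zero v \<longleftrightarrow> (\<forall>a b. a \<noteq> b \<longrightarrow> v $ a $ b = 0)"

definition off_diagonal_skew :: "complex^'n^'n \<Rightarrow> bool" where
  "off_diagonal_skew v \<longleftrightarrow> (\<forall>a b. a \<noteq> b \<longrightarrow> v $ a $ b + v $ b $ a = 0)"

definition line_sums :: "complex^'n^'n \<Rightarrow> complex \<Rightarrow> bool" where
  "line_sums v z \<longleftrightarrow> (\<forall>a. (\<Sum>x\<in>UNIV. v $ a $ x) = z) \<and> (\<forall>a. (\<Sum>x\<in>UNIV. v $ x $ a) = z)"

lemma finite_points [simp]: "finite (points k l)"
  by (simp add: points_def)

lemma points_split:
  "points (length c) (length d) = white_lower_black_upper c d \<union> black_lower_white_upper c d"
  "white_lower_black_upper c d \<inter> black_lower_white_upper c d = {}"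
proof -
  have x: "x = Black \<longleftrightarrow> x \<noteq> White" for x by (cases x) auto
  show "points (length c) (length d) = white_lower_black_upper c d \<union> black_lower_white_upper c d"
    by (auto simp: points_def white_lower_black_upper_def black_lower_white_upper_def x)
  show "white_lower_black_upper c d \<inter> black_lower_white_upper c d = {}"
    by (auto simp: white_lower_black_upper_def black_lower_white_upper_def)
qed

lemma charge_eq:
  assumes "B \<subseteq> points (length c) (length d)"
  shows "charge (white_lower_black_upper c d) B =
    of_nat (card (B \<inter> white_lower_black_upper c d)) - of_nat (card (B \<inter> black_lower_white_upper c d))"
proof -
  let ?w = "white_lower_black_upper c d" and ?b = "black_lower_white_upper c d"
  have fin: "finite B" using assms by (rule finite_subset) simp
  have B: "B \<inter> - ?w = B \<inter> ?b" using assms points_split[of c d] by blast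
  have "charge ?w B = (\<Sum>P\<in>B \<inter> ?w. 1) + (\<Sum>P\<in>B \<inter> - ?w. - 1)"
    unfolding charge_def sum.If_cases[OF fin] by simp
  then show ?thesis by (simp add: B)
qed

lemma block_sum_large: "card B \<noteq> 1 \<Longrightarrow> block_sum v pos B a = charge pos B * v $ a $ a"
  by (simp add: block_sum_def charge_def weight_def sum_distrib_right if_distrib[of "\<lambda>x. x * _"] cong: if_cong)

lemma block_sum_singleton:
  "block_sum v pos {P} a = (if P \<in> pos then \<Sum>x\<in>UNIV. v $ a $ x else - (\<Sum>x\<in>UNIV. v $ x $ a))"
  by (simp add: block_sum_def weight_def sum_negf)

context
  fixes C :: "tcp set"
  assumes category: "partition_category C"
begin

lemma block_in_points:
  assumes "(c, d, p) \<in> C" "B \<in> p"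
  shows "B \<subseteq> points (length c) (length d)" "finite B" "B \<noteq> {}"
proof -
  show B: "B \<subseteq> points (length c) (length d)"
    using partition_onD1[OF in_category_partition[OF category assms(1)]] assms(2) by auto
  show "finite B" using B by (rule finite_subset) simp
  show "B \<noteq> {}" using partition_onD3[OF in_category_partition[OF category assms(1)]] assms(2) by auto
qed

lemma property3_iff_charge:
  "property3 C \<longleftrightarrow> (\<forall>c d p B. (c, d, p) \<in> C \<longrightarrow> B \<in> p \<longrightarrow> card B \<ge> 2 \<longrightarrow>
     charge (white_lower_black_upper c d) B = 0)"
proof -
  have "charge (white_lower_black_upper c d) B = 0 \<longleftrightarrow>
     card (B \<inter> white_lower_black_upper c d) = card (B \<inter> black_lower_white_upper c d)"
    if "(c, d, p) \<in> C" "B \<in> p" for c d p B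
    using charge_eq[OF block_in_points(1)[OF that]] by simp
  then show ?thesis unfolding property3_def by (simp add: Ball_def)
qed

lemma property4_iff_charge:
  "property4 C \<longleftrightarrow> (\<forall>c d p. (c, d, p) \<in> C \<longrightarrow>
     charge (white_lower_black_upper c d) (points (length c) (length d)) = 0)"
proof -
  have "charge (white_lower_black_upper c d) (points (length c) (length d)) = 0 \<longleftrightarrow>
     card (white_lower_black_upper c d) = card (black_lower_white_upper c d)" for c d
  proof -
    have "points (length c) (length d) \<inter> white_lower_black_upper c d = white_lower_black_upper c d"
      "points (length c) (length d) \<inter> black_lower_white_upper c d = black_lower_white_upper c d"
      using points_split(1)[of c d] by auto
    then show ?thesis using charge_eq[OF order_refl, of c d] by simp
  qed
  then show ?thesis unfolding property4_def by (simp add: Ball_def)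
qed

text \<open>In each case of the theorem a scalar \<open>z\<close> with these properties makes the
  matrix behave on blocks like \<open>z\<close> times the identity; all that remains of the
  constant labellings is then \<open>z\<close> times the total charge.\<close>

lemma block_sum_scalar:
  fixes v :: "complex^'n^'n"
  assumes singles: "property2 C \<or> line_sums v z"
    and large: "property3 C \<or> (\<forall>a. v $ a $ a = z)"
    and p: "(c, d, p) \<in> C" and B: "B \<in> p"
  shows "block_sum v (white_lower_black_upper c d) B a = charge (white_lower_black_upper c d) B * z"
proof (cases "card B = 1")
  case True
  then obtain P where P: "B = {P}" by (auto simp: card_1_singleton_iff)
  have "\<not> property2 C" unfolding property2_def using p B True by force
  then have "line_sums v z" using singles by simp
  then show ?thesis unfolding P block_sum_singleton by (simp add: charge_def line_sums_def)
next
  case False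
  have "charge (white_lower_black_upper c d) B = 0 \<or> v $ a $ a = z"
  proof (cases "property3 C")
    case True
    have "card B \<noteq> 0" using block_in_points[OF p B] by simp
    with False have "card B \<ge> 2" by linarith
    then show ?thesis using True p B property3_iff_charge by blast
  qed (use large in simp)
  then show ?thesis unfolding block_sum_large[OF False] by auto
qed

lemma solutionsI:
  fixes v :: "complex^'n^'n"
  assumes singles: "property2 C \<or> line_sums v z"
    and large: "property3 C \<or> (\<forall>a. v $ a $ a = z)"
    and total: "property4 C \<or> z = 0"
    and off: "off_diagonal_zero v \<or> property1 C \<and> (property3 C \<or> off_diagonal_skew v)"
  shows "v \<in> solutions C"
  unfolding solutions_def
proof (intro CollectI allI impI)
  fix c d p and f :: "point \<Rightarrow> 'n" assume p: "(c, d, p) \<in> C"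
  let ?pos = "white_lower_black_upper c d"
  show "defect v (points (length c) (length d)) ?pos p f = 0"
  proof (rule defect_zeroI[OF in_category_partition[OF category p] finite_points])
    show "charge ?pos (points (length c) (length d)) * z = 0"
      using total p property4_iff_charge by auto
  next
    show "block_sum v ?pos B a = charge ?pos B * z" if "B \<in> p" for B a
      by (rule block_sum_scalar[OF singles large p that])
  next
    show "(\<forall>a b. a \<noteq> b \<longrightarrow> v $ a $ b = 0) \<or>
      (\<forall>B\<in>p. card B \<le> 2) \<and> (\<forall>P Q a b. {P, Q} \<in> p \<longrightarrow> P \<noteq> Q \<longrightarrow> a \<noteq> b \<longrightarrow>
        weight v ?pos P a b + weight v ?pos Q b a = 0)"
      using off
    proof
      assume "off_diagonal_zero v"
      then show ?thesis unfolding off_diagonal_zero_def by blast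
    next
      assume off: "property1 C \<and> (property3 C \<or> off_diagonal_skew v)"
      have "\<forall>B\<in>p. card B \<le> 2" using off p unfolding property1_def by blast
      moreover have "weight v ?pos P a b + weight v ?pos Q b a = 0"
        if PQ: "{P, Q} \<in> p" "P \<noteq> Q" "a \<noteq> b" for P Q a b
      proof (cases "P \<in> ?pos \<longleftrightarrow> Q \<in> ?pos")
        case True
        then have "charge ?pos {P, Q} \<noteq> 0" using PQ by (auto simp: charge_def)
        moreover have "card {P, Q} \<ge> 2" using PQ by simp
        ultimately have "\<not> property3 C" using p PQ property3_iff_charge by blast
        then have "v $ a $ b + v $ b $ a = 0" using off PQ unfolding off_diagonal_skew_def by blast
        then have "v $ b $ a = - v $ a $ b" by (simp add: add_eq_0_iff)
        then show ?thesis using True by (simp add: weight_def)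
      next
        case False
        then show ?thesis by (auto simp: weight_def)
      qed
      ultimately show ?thesis by blast
    qed
  qed
qed

context
  fixes v :: "complex^'n^'n"
  assumes v: "v \<in> solutions C"
begin

lemma solution_defect:
  "(c, d, p) \<in> C \<Longrightarrow>
    defect v (points (length c) (length d)) (white_lower_black_upper c d) p f = 0"
  using v unfolding solutions_def by blast

lemma solution_off_diagonal_zero:
  assumes "\<not> property1 C"
  shows "off_diagonal_zero v"
proof -
  obtain c d p B where p: "(c, d, p) \<in> C" "B \<in> p" "card B \<ge> 3"
    using assms unfolding property1_def by force
  then obtain P where P: "P \<in> B" by fastforce
  have w: "weight v (white_lower_black_upper c d) P a b = 0" if "a \<noteq> b" for a b
    using defect_one_point_large[OF in_category_partition[OF category p(1)] finite_points p(2) P p(3) that]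
      solution_defect[OF p(1)] by metis
  show ?thesis unfolding off_diagonal_zero_def
  proof (intro allI impI)
    fix a b :: 'n assume ab: "a \<noteq> b"
    show "v $ a $ b = 0"
      using w[OF ab] w[OF ab[symmetric]] by (simp add: weight_def split: if_splits)
  qed
qed

lemma solution_off_diagonal_skew:
  assumes "property1 C" "\<not> property3 C"
  shows "off_diagonal_skew v"
proof -
  obtain c d p B where p: "(c, d, p) \<in> C" "B \<in> p" "card B \<ge> 2"
      "charge (white_lower_black_upper c d) B \<noteq> 0"
    using assms(2) property3_iff_charge by blast
  then have "card B = 2" using assms(1) unfolding property1_def by force
  then obtain P Q where PQ: "B = {P, Q}" "P \<noteq> Q" by (auto simp: card_2_iff)
  let ?pos = "white_lower_black_upper c d"
  have w: "weight v ?pos P a b + weight v ?pos Q b a = 0" if "a \<noteq> b" for a b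
    using defect_one_point_pair[OF in_category_partition[OF category p(1)] finite_points _ PQ(2) that]
      solution_defect[OF p(1)] p(2) PQ(1) by metis
  have same: "P \<in> ?pos \<longleftrightarrow> Q \<in> ?pos" using p(4) PQ by (auto simp: charge_def split: if_splits)
  have "v $ a $ b + v $ b $ a = 0" if "a \<noteq> b" for a b
  proof (cases "P \<in> ?pos")
    case True
    then show ?thesis using w[OF that] same by (simp add: weight_def)
  next
    case False
    then have "- (v $ a $ b + v $ b $ a) = 0"
      using w[OF that[symmetric]] same by (simp add: weight_def)
    then show ?thesis by (simp only: neg_equal_0_iff_equal)
  qed
  then show ?thesis unfolding off_diagonal_skew_def by blast
qed

lemma solution_diagonal_constant:
  assumes "\<not> property3 C"
  shows "\<exists>z. \<forall>a. v $ a $ a = z"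
proof -
  obtain c d p B where p: "(c, d, p) \<in> C" "B \<in> p" "card B \<ge> 2"
      "charge (white_lower_black_upper c d) B \<noteq> 0"
    using assms property3_iff_charge by blast
  let ?pos = "white_lower_black_upper c d"
  have "card B \<noteq> 1" using p(3) by simp
  then have "charge ?pos B * v $ a $ a = charge ?pos B * v $ b $ b" for a b
    using defect_zero_blocks(1)[OF in_category_partition[OF category p(1)] finite_points
        solution_defect[OF p(1)] p(2), of a b]
    by (simp only: block_sum_large not_False_eq_True)
  then have "v $ a $ a = v $ b $ b" for a b using p(4) by simp
  then show ?thesis by blast
qed

lemma solution_singleton_sum:
  assumes p: "(c, d, p) \<in> C" and P: "{P} \<in> p"
  shows "if P \<in> white_lower_black_upper c d
    then (\<Sum>x\<in>UNIV. v $ a $ x) = (\<Sum>x\<in>UNIV. v $ b $ x)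
    else (\<Sum>x\<in>UNIV. v $ x $ a) = (\<Sum>x\<in>UNIV. v $ x $ b)"
  using defect_zero_blocks(1)[OF in_category_partition[OF category p] finite_points
      solution_defect[OF p] P, of a b]
  unfolding block_sum_singleton by (simp split: if_splits)

text \<open>The adjoint turns the given singleton into one of opposite charge, so that both row
  sums and column sums are constant. Adding up all entries in two ways shows that the two
  constants agree.\<close>

lemma solution_line_sums:
  assumes "\<not> property2 C"
  shows "\<exists>z. line_sums v z"
proof -
  obtain c d p B where p: "(c, d, p) \<in> C" "B \<in> p" "card B < 2"
    using assms unfolding property2_def by force
  have "card B \<noteq> 0" using block_in_points[OF p(1,2)] by simp
  then have "card B = 1" using p(3) by linarith
  then obtain P where P: "{P} \<in> p" using p(2) by (auto simp: card_1_singleton_iff)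
  have P_in: "P \<in> points (length c) (length d)" using block_in_points(1)[OF p(1) P] by simp
  have "flip_point ` {P} \<in> adjoint_partition p" unfolding adjoint_partition_def using P by blast
  then have P': "{flip_point P} \<in> adjoint_partition p" by simp
  note adj = category_adjoint[OF category p(1)]
  have flip: "flip_point P \<in> white_lower_black_upper d c \<longleftrightarrow> P \<notin> white_lower_black_upper c d"
  proof -
    have x: "x = Black \<longleftrightarrow> x \<noteq> White" for x by (cases x) auto
    show ?thesis
      using P_in by (cases P) (auto simp: points_def white_lower_black_upper_def x)
  qed
  have row: "(\<Sum>x\<in>UNIV. v $ a $ x) = (\<Sum>x\<in>UNIV. v $ b $ x)"
    and col: "(\<Sum>x\<in>UNIV. v $ x $ a) = (\<Sum>x\<in>UNIV. v $ x $ b)" for a b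
    using solution_singleton_sum[OF p(1) P, of a b] solution_singleton_sum[OF adj P', of a b]
    unfolding flip by (simp_all split: if_splits)
  let ?i = "undefined :: 'n"
  have "(\<Sum>a\<in>UNIV. \<Sum>x\<in>UNIV. v $ a $ x) = (\<Sum>x\<in>UNIV. \<Sum>a\<in>UNIV. v $ a $ x)" by (rule sum.swap)
  moreover have "(\<Sum>a\<in>UNIV. \<Sum>x\<in>UNIV. v $ a $ x) = (\<Sum>a\<in>(UNIV :: 'n set). \<Sum>x\<in>UNIV. v $ ?i $ x)"
    by (intro sum.cong refl row)
  moreover have "(\<Sum>x\<in>UNIV. \<Sum>a\<in>UNIV. v $ a $ x) = (\<Sum>x\<in>(UNIV :: 'n set). \<Sum>a\<in>UNIV. v $ a $ ?i)"
    by (intro sum.cong refl col)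
  ultimately have "(\<Sum>x\<in>UNIV. v $ ?i $ x) = (\<Sum>a\<in>UNIV. v $ a $ ?i)" by simp
  then have "line_sums v (\<Sum>x\<in>UNIV. v $ ?i $ x)"
    unfolding line_sums_def using row[of _ ?i] col[of _ ?i] by metis
  then show ?thesis ..
qed

lemma solution_scalar_zero:
  assumes singles: "property2 C \<or> line_sums v z"
    and large: "property3 C \<or> (\<forall>a. v $ a $ a = z)"
    and "\<not> property4 C"
  shows "z = 0"
proof -
  obtain c d p where p: "(c, d, p) \<in> C"
    and ch: "charge (white_lower_black_upper c d) (points (length c) (length d)) \<noteq> 0"
    using assms(3) property4_iff_charge by blast
  let ?pos = "white_lower_black_upper c d"
  note part = in_category_partition[OF category p]
  let ?i = "undefined :: 'n"
  have "block_sum v ?pos B ?i = charge ?pos B * z" if "B \<in> p" for B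
    by (rule block_sum_scalar[OF singles large p that])
  then have "(\<Sum>B\<in>p. block_sum v ?pos B ?i) = (\<Sum>B\<in>p. charge ?pos B * z)" by (rule sum.cong[OF refl])
  moreover have "(\<Sum>B\<in>p. block_sum v ?pos B ?i) = 0"
    by (rule defect_zero_blocks(2)[OF part finite_points solution_defect[OF p]])
  ultimately have "charge ?pos (points (length c) (length d)) * z = 0"
    by (simp add: charge_total[OF part finite_points] sum_distrib_right)
  then show ?thesis using ch by simp
qed

end

end

section \<open>Derivations of the free algebra\<close>

lemma poly_additive_ext:
  fixes F G :: "('a \<Rightarrow>\<^sub>0 'b::comm_monoid_add) \<Rightarrow> complex"
  assumes F: "\<And>f g. F (f + g) = F f + F g" and G: "\<And>f g. G (f + g) = G f + G g"
    and eq: "\<And>w a. F (Poly_Mapping.single w a) = G (Poly_Mapping.single w a)"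
  shows "F f = G f"
proof (induction f rule: Poly_Mapping.update_induct)
  case const
  show ?case using eq[of undefined 0] by simp
next
  case (update f a b)
  have "Poly_Mapping.update a b f = f + Poly_Mapping.single a b"
    using update(1) by (intro poly_mapping_eqI)
      (auto simp: lookup_update lookup_add lookup_single in_keys_iff when_def)
  then show ?case using F G eq update(3) by simp
qed

definition linear_extension :: "('a \<Rightarrow> complex) \<Rightarrow> ('a \<Rightarrow>\<^sub>0 complex) \<Rightarrow> complex" where
  "linear_extension \<phi> f = (\<Sum>w\<in>Poly_Mapping.keys f. Poly_Mapping.lookup f w * \<phi> w)"

lemma linear_extension_superset:
  "finite S \<Longrightarrow> Poly_Mapping.keys f \<subseteq> S \<Longrightarrow> linear_extension \<phi> f = (\<Sum>w\<in>S. Poly_Mapping.lookup f w * \<phi> w)"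
  unfolding linear_extension_def by (rule sum.mono_neutral_left) (auto simp: in_keys_iff)

lemma linear_extension_add: "linear_extension \<phi> (f + g) = linear_extension \<phi> f + linear_extension \<phi> g"
proof -
  let ?S = "Poly_Mapping.keys f \<union> Poly_Mapping.keys g"
  have "linear_extension \<phi> (f + g) = (\<Sum>w\<in>?S. Poly_Mapping.lookup (f + g) w * \<phi> w)"
    by (rule linear_extension_superset) (use keys_add[of f g] in auto)
  also have "\<dots> = (\<Sum>w\<in>?S. Poly_Mapping.lookup f w * \<phi> w) + (\<Sum>w\<in>?S. Poly_Mapping.lookup g w * \<phi> w)"
    by (simp add: lookup_add distrib_right sum.distrib)
  also have "\<dots> = linear_extension \<phi> f + linear_extension \<phi> g"
    by (simp add: linear_extension_superset[symmetric])
  finally show ?thesis .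
qed

lemma linear_extension_single [simp]: "linear_extension \<phi> (Poly_Mapping.single w a) = a * \<phi> w"
  by (subst linear_extension_superset[of "{w}"]) auto

lemma linear_extension_zero [simp]: "linear_extension \<phi> 0 = 0"
  by (simp add: linear_extension_def)

lemma linear_extension_uminus: "linear_extension \<phi> (- f) = - linear_extension \<phi> f"
  using linear_extension_add[of \<phi> f "- f"] by (simp add: eq_neg_iff_add_eq_0 add.commute)

lemma linear_extension_diff: "linear_extension \<phi> (f - g) = linear_extension \<phi> f - linear_extension \<phi> g"
  using linear_extension_add[of \<phi> f "- g"] by (simp add: linear_extension_uminus)

lemma linear_extension_sum: "linear_extension \<phi> (\<Sum>i\<in>S. f i) = (\<Sum>i\<in>S. linear_extension \<phi> (f i))"
  by (induction S rule: infinite_finite_induct) (simp_all add: linear_extension_add)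

lemma linear_extension_of_bool_mult:
  fixes f :: "'a::monoid_add \<Rightarrow>\<^sub>0 complex"
  shows "linear_extension \<phi> (of_bool b * f) = of_bool b * linear_extension \<phi> f"
  by (cases b) simp_all

text \<open>Both sides are biadditive, hence it suffices to compare them on pairs of
  words.\<close>

lemma linear_extension_derivation:
  fixes f g :: "'a::monoid_add \<Rightarrow>\<^sub>0 complex"
  assumes "\<And>v w. \<phi> (v + w) = \<epsilon> v * \<phi> w + \<phi> v * \<epsilon> w"
  shows "linear_extension \<phi> (f * g) = linear_extension \<epsilon> f * linear_extension \<phi> g + linear_extension \<phi> f * linear_extension \<epsilon> g"
proof (rule poly_additive_ext[of "\<lambda>f. linear_extension \<phi> (f * g)"])
  fix w a
  show "linear_extension \<phi> (Poly_Mapping.single w a * g) =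
    linear_extension \<epsilon> (Poly_Mapping.single w a) * linear_extension \<phi> g + linear_extension \<phi> (Poly_Mapping.single w a) * linear_extension \<epsilon> g"
    by (rule poly_additive_ext[of "\<lambda>g. linear_extension \<phi> (Poly_Mapping.single w a * g)"])
      (simp_all add: distrib_left linear_extension_add mult_single assms algebra_simps)
qed (simp_all add: distrib_left distrib_right linear_extension_add algebra_simps)

lemma linear_extension_multiplicative:
  fixes f g :: "'a::monoid_add \<Rightarrow>\<^sub>0 complex"
  assumes "\<And>v w. \<epsilon> (v + w) = \<epsilon> v * \<epsilon> w"
  shows "linear_extension \<epsilon> (f * g) = linear_extension \<epsilon> f * linear_extension \<epsilon> g"
proof (rule poly_additive_ext[of "\<lambda>f. linear_extension \<epsilon> (f * g)"])
  fix w a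
  show "linear_extension \<epsilon> (Poly_Mapping.single w a * g) = linear_extension \<epsilon> (Poly_Mapping.single w a) * linear_extension \<epsilon> g"
    by (rule poly_additive_ext[of "\<lambda>g. linear_extension \<epsilon> (Poly_Mapping.single w a * g)"])
      (simp_all add: distrib_left linear_extension_add mult_single assms algebra_simps)
qed (simp_all add: distrib_left distrib_right linear_extension_add algebra_simps)

fun word_counit :: "(color \<times> 'n \<times> 'n) list \<Rightarrow> complex" where
  "word_counit [] = 1"
| "word_counit ((x, j, i) # w) = of_bool (j = i) * word_counit w"

text \<open>The derivation over the counit of the free algebra with prescribed values on the
  letters.\<close>

fun word_derivation :: "(color \<Rightarrow> 'n \<Rightarrow> 'n \<Rightarrow> complex) \<Rightarrow> (color \<times> 'n \<times> 'n) list \<Rightarrow> complex" where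
  "word_derivation \<theta> [] = 0"
| "word_derivation \<theta> ((x, j, i) # w) =
     of_bool (j = i) * word_derivation \<theta> w + \<theta> x j i * word_counit w"

definition counit :: "'n poly_alg \<Rightarrow> complex" where
  "counit = linear_extension (\<lambda>w. word_counit (letters w))"

definition derivation :: "(color \<Rightarrow> 'n \<Rightarrow> 'n \<Rightarrow> complex) \<Rightarrow> 'n poly_alg \<Rightarrow> complex" where
  "derivation \<theta> = linear_extension (\<lambda>w. word_derivation \<theta> (letters w))"

lemma word_counit_append: "word_counit (v @ w) = word_counit v * word_counit w"
  by (induction v rule: word_counit.induct) simp_all

lemma word_derivation_append:
  "word_derivation \<theta> (v @ w) = word_counit v * word_derivation \<theta> w + word_derivation \<theta> v * word_counit w"
  by (induction v rule: word_counit.induct) (simp_all add: word_counit_append algebra_simps)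

lemma counit_mult: "counit (f * g) = counit f * counit g"
  unfolding counit_def
  by (rule linear_extension_multiplicative) (simp add: plus_free_monoid_def word_counit_append)

lemma derivation_mult:
  "derivation \<theta> (f * g) = counit f * derivation \<theta> g + derivation \<theta> f * counit g"
  unfolding counit_def derivation_def
  by (rule linear_extension_derivation) (simp add: plus_free_monoid_def word_derivation_append)

lemma counit_gen [simp]: "counit (gen_u x j i) = of_bool (j = i)"
  by (simp add: counit_def gen_u_def)

lemma derivation_gen [simp]: "derivation \<theta> (gen_u x j i) = \<theta> x j i"
  by (simp add: derivation_def gen_u_def)

lemma prod_list_letters:
  "(\<Prod>s\<leftarrow>ss. Poly_Mapping.single (Letters [h s]) 1) = (Poly_Mapping.single (Letters (map h ss)) 1 :: 'n poly_alg)"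
proof (induction ss)
  case Nil
  show ?case by (simp add: zero_free_monoid_def[symmetric])
next
  case (Cons s ss)
  then show ?case by (simp add: mult_single plus_free_monoid_def)
qed

lemma gen_u_prod_eq:
  "gen_u_prod c j i = Poly_Mapping.single (Letters (map (\<lambda>s. (c ! s, j ! s, i ! s)) [0..<length c])) 1"
  unfolding gen_u_prod_def gen_u_def by (rule prod_list_letters)

lemma word_counit_map:
  "word_counit (map (\<lambda>s. (c s, j s, i s)) ss) = of_bool (\<forall>t\<in>set ss. j t = i t)"
  by (induction ss) auto

lemma word_derivation_map:
  "distinct ss \<Longrightarrow> word_derivation \<theta> (map (\<lambda>s. (c s, j s, i s)) ss) =
    (\<Sum>s\<in>set ss. of_bool (\<forall>t\<in>set ss - {s}. j t = i t) * \<theta> (c s) (j s) (i s))"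
proof (induction ss)
  case (Cons r ss)
  have r: "r \<notin> set ss" using Cons(2) by simp
  let ?A = "\<lambda>s. of_bool (\<forall>t\<in>set (r # ss) - {s}. j t = i t) * \<theta> (c s) (j s) (i s)"
  let ?B = "\<lambda>s. of_bool (\<forall>t\<in>set ss - {s}. j t = i t) * \<theta> (c s) (j s) (i s)"
  have A: "?A s = of_bool (j r = i r) * ?B s" if "s \<in> set ss" for s
  proof -
    have "set (r # ss) - {s} = insert r (set ss - {s})" using r that by auto
    then show ?thesis by (simp only: ball_simps of_bool_conj) (simp only: mult.assoc)
  qed
  have "set (r # ss) - {r} = set ss" using r by auto
  then have Ar: "?A r = word_counit (map (\<lambda>s. (c s, j s, i s)) ss) * \<theta> (c r) (j r) (i r)"
    by (simp only: word_counit_map)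
  have "(\<Sum>s\<in>set (r # ss). ?A s) = ?A r + (\<Sum>s\<in>set ss. ?A s)"
    using sum.insert[OF finite_set r, of ?A] by (simp only: list.set)
  also have "(\<Sum>s\<in>set ss. ?A s) = (\<Sum>s\<in>set ss. of_bool (j r = i r) * ?B s)"
    by (intro sum.cong refl A)
  also have "\<dots> = of_bool (j r = i r) * (\<Sum>s\<in>set ss. ?B s)"
    by (rule sum_distrib_left[symmetric])
  also have "(\<Sum>s\<in>set ss. ?B s) = word_derivation \<theta> (map (\<lambda>s. (c s, j s, i s)) ss)"
    by (rule Cons.IH[symmetric]) (use Cons.prems in simp)
  finally have sum: "(\<Sum>s\<in>set (r # ss). ?A s) =
    word_counit (map (\<lambda>s. (c s, j s, i s)) ss) * \<theta> (c r) (j r) (i r) +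
    of_bool (j r = i r) * word_derivation \<theta> (map (\<lambda>s. (c s, j s, i s)) ss)"
    unfolding Ar .
  show ?case unfolding sum list.map word_derivation.simps
    by (subst add.commute) (rule arg_cong2[where f = "(+)", OF mult.commute refl])
qed simp

lemma counit_gen_u_prod:
  assumes "length j = length c" "length i = length c"
  shows "counit (gen_u_prod c j i) = of_bool (j = i)"
proof -
  have "(\<forall>t\<in>set [0..<length c]. j ! t = i ! t) \<longleftrightarrow> j = i"
    using nth_equalityI[of j i] assms by (metis atLeastLessThan_iff le0 set_upt)
  then show ?thesis
    by (simp add: counit_def gen_u_prod_eq word_counit_map del: set_upt)
qed

lemma derivation_gen_u_prod:
  "derivation \<theta> (gen_u_prod c j i) =
    (\<Sum>s<length c. of_bool (\<forall>t\<in>{..<length c} - {s}. j ! t = i ! t) * \<theta> (c ! s) (j ! s) (i ! s))"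
  by (simp add: derivation_def gen_u_prod_eq word_derivation_map atLeast0LessThan)

lemma agree_except_iff:
  assumes "length j = l" "s < l"
  shows "length i = l \<and> (\<forall>t\<in>{..<l} - {s}. j ! t = i ! t) \<longleftrightarrow> i \<in> range (\<lambda>x. j[s := x])"
proof
  assume *: "length i = l \<and> (\<forall>t\<in>{..<l} - {s}. j ! t = i ! t)"
  have "i = j[s := i ! s]"
    by (rule nth_equalityI) (use * assms in \<open>auto simp: nth_list_update\<close>)
  then show "i \<in> range (\<lambda>x. j[s := x])" by blast
next
  assume "i \<in> range (\<lambda>x. j[s := x])"
  then obtain x where "i = j[s := x]" by blast
  then show "length i = l \<and> (\<forall>t\<in>{..<l} - {s}. j ! t = i ! t)"
    using assms by (simp add: nth_list_update)
qed

lemma finite_lists: "finite {i :: 'n::finite list. length i = l}"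
  using finite_lists_length_eq[of "UNIV :: 'n set" l] by simp

lemma sum_agree_except:
  fixes G :: "'n::finite list \<Rightarrow> complex"
  assumes j: "length j = l" "s < l"
  shows "(\<Sum>i | length i = l. of_bool (\<forall>t\<in>{..<l} - {s}. j ! t = i ! t) * G i) = (\<Sum>x\<in>UNIV. G (j[s := x]))"
proof -
  let ?agree = "\<lambda>i. \<forall>t\<in>{..<l} - {s}. j ! t = i ! t"
  have sets: "{i \<in> {i. length i = l}. ?agree i} = range (\<lambda>x. j[s := x])"
    using agree_except_iff[OF j] by blast
  have inj: "inj (\<lambda>x. j[s := x])"
  proof (rule injI)
    fix x y assume "j[s := x] = j[s := y]"
    from arg_cong[OF this, of "\<lambda>i. i ! s"] show "x = y" using j by simp
  qed
  have "(\<Sum>i | length i = l. of_bool (?agree i) * G i) = (\<Sum>i | length i = l. if ?agree i then G i else 0)"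
    by (intro sum.cong refl) simp
  also have "\<dots> = (\<Sum>i\<in>{i \<in> {i. length i = l}. ?agree i}. G i)"
    by (rule sum.inter_filter[OF finite_lists, symmetric])
  also have "\<dots> = (\<Sum>x\<in>UNIV. G (j[s := x]))"
    unfolding sets by (simp add: sum.reindex[OF inj] o_def)
  finally show ?thesis .
qed

text \<open>A word contributes to the derivation only if at most one letter is off-diagonal, so
  that a sum over all index lists collapses to a sum over the changes of a single index.\<close>

lemma sum_derivation_gen_u_prod:
  fixes Z :: "'n::finite list \<Rightarrow> complex"
  assumes "length j = length c"
  shows "(\<Sum>i | length i = length c. Z i * derivation \<theta> (gen_u_prod c j i))
      = (\<Sum>s<length c. \<Sum>x\<in>UNIV. Z (j[s := x]) * \<theta> (c ! s) (j ! s) x)"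
    and "(\<Sum>i | length i = length c. Z i * derivation \<theta> (gen_u_prod c i j))
      = (\<Sum>s<length c. \<Sum>x\<in>UNIV. Z (j[s := x]) * \<theta> (c ! s) x (j ! s))"
proof -
  let ?A = "\<lambda>s i. of_bool (\<forall>t\<in>{..<length c} - {s}. j ! t = i ! t) :: complex"
  have "(\<Sum>i | length i = length c. Z i * derivation \<theta> (gen_u_prod c j i))
      = (\<Sum>i | length i = length c. \<Sum>s<length c. ?A s i * (Z i * \<theta> (c ! s) (j ! s) (i ! s)))"
    unfolding derivation_gen_u_prod sum_distrib_left by (intro sum.cong refl) (simp only: mult.left_commute)
  also have "\<dots> = (\<Sum>s<length c. \<Sum>i | length i = length c. ?A s i * (Z i * \<theta> (c ! s) (j ! s) (i ! s)))"
    by (rule sum.swap)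
  also have "\<dots> = (\<Sum>s<length c. \<Sum>x\<in>UNIV. Z (j[s := x]) * \<theta> (c ! s) (j ! s) x)"
  proof (intro sum.cong refl)
    fix s assume s: "s \<in> {..<length c}"
    show "(\<Sum>i | length i = length c. ?A s i * (Z i * \<theta> (c ! s) (j ! s) (i ! s)))
      = (\<Sum>x\<in>UNIV. Z (j[s := x]) * \<theta> (c ! s) (j ! s) x)"
      using sum_agree_except[OF assms, of s "\<lambda>i. Z i * \<theta> (c ! s) (j ! s) (i ! s)"] s assms by simp
  qed
  finally show "(\<Sum>i | length i = length c. Z i * derivation \<theta> (gen_u_prod c j i))
      = (\<Sum>s<length c. \<Sum>x\<in>UNIV. Z (j[s := x]) * \<theta> (c ! s) (j ! s) x)" .
  have "(\<Sum>i | length i = length c. Z i * derivation \<theta> (gen_u_prod c i j))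
      = (\<Sum>i | length i = length c. \<Sum>s<length c. ?A s i * (Z i * \<theta> (c ! s) (i ! s) (j ! s)))"
    unfolding derivation_gen_u_prod sum_distrib_left
    by (intro sum.cong refl) (simp only: mult.left_commute eq_commute[of "_ ! _" "j ! _"])
  also have "\<dots> = (\<Sum>s<length c. \<Sum>i | length i = length c. ?A s i * (Z i * \<theta> (c ! s) (i ! s) (j ! s)))"
    by (rule sum.swap)
  also have "\<dots> = (\<Sum>s<length c. \<Sum>x\<in>UNIV. Z (j[s := x]) * \<theta> (c ! s) x (j ! s))"
  proof (intro sum.cong refl)
    fix s assume s: "s \<in> {..<length c}"
    show "(\<Sum>i | length i = length c. ?A s i * (Z i * \<theta> (c ! s) (i ! s) (j ! s)))
      = (\<Sum>x\<in>UNIV. Z (j[s := x]) * \<theta> (c ! s) x (j ! s))"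
      using sum_agree_except[OF assms, of s "\<lambda>i. Z i * \<theta> (c ! s) (i ! s) (j ! s)"] s assms by simp
  qed
  finally show "(\<Sum>i | length i = length c. Z i * derivation \<theta> (gen_u_prod c i j))
      = (\<Sum>s<length c. \<Sum>x\<in>UNIV. Z (j[s := x]) * \<theta> (c ! s) x (j ! s))" .
qed

lemma refines_kernel_iff:
  assumes p: "partition_on X p"
  shows "refines X p (kernel_partition X f) \<longleftrightarrow> constant_on_blocks p f"
proof -
  have ker: "partition_on X (kernel_partition X f)"
    by (rule partition_onI) (auto simp: kernel_partition_def disjnt_def)
  have "(\<exists>Y\<in>kernel_partition X f. B \<subseteq> Y) \<longleftrightarrow> (\<forall>x\<in>B. \<forall>y\<in>B. f x = f y)" if "B \<in> p" for B
  proof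
    assume "\<exists>Y\<in>kernel_partition X f. B \<subseteq> Y"
    then obtain y where "B \<subseteq> {x \<in> X. f x = y}" unfolding kernel_partition_def by blast
    then have "f x = y" if "x \<in> B" for x using that by blast
    then show "\<forall>x\<in>B. \<forall>y\<in>B. f x = f y" by simp
  next
    assume c: "\<forall>x\<in>B. \<forall>y\<in>B. f x = f y"
    have "B \<noteq> {}" using partition_onD3[OF p] that by metis
    then obtain x where x: "x \<in> B" by blast
    have B: "B \<subseteq> X" using partition_onD1[OF p] that by auto
    have "{y \<in> X. f y = f x} \<in> kernel_partition X f"
      unfolding kernel_partition_def using x B by blast
    moreover have "B \<subseteq> {y \<in> X. f y = f x}" using c x B by blast
    ultimately show "\<exists>Y\<in>kernel_partition X f. B \<subseteq> Y" by blast
  qed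
  then show ?thesis unfolding refines_def constant_on_blocks_def using p ker by simp
qed

lemma zeta_kernel:
  "partition_on X p \<Longrightarrow> zeta X p (kernel_partition X f) = of_bool (constant_on_blocks p f)"
  by (simp add: zeta_def refines_kernel_iff)

lemma derivation_relation_poly:
  fixes j g :: "'n::finite list"
  assumes p: "partition_on (points (length c) (length d)) p"
    and len: "length g = length c" "length j = length d"
  shows "derivation \<theta> (relation_poly c d p j g) =
    (\<Sum>s<length d. \<Sum>x\<in>UNIV. of_bool (constant_on_blocks p (diamond g (j[s := x]))) * \<theta> (d ! s) (j ! s) x) -
    (\<Sum>s<length c. \<Sum>x\<in>UNIV. of_bool (constant_on_blocks p (diamond (g[s := x]) j)) * \<theta> (c ! s) x (g ! s))"
proof -
  have "derivation \<theta> (relation_poly c d p j g) =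
    (\<Sum>i | length i = length d. of_bool (constant_on_blocks p (diamond g i)) * derivation \<theta> (gen_u_prod d j i)) -
    (\<Sum>h | length h = length c. of_bool (constant_on_blocks p (diamond h j)) * derivation \<theta> (gen_u_prod c h g))"
    unfolding relation_poly_def Let_def zeta_kernel[OF p] derivation_def
    by (simp only: linear_extension_diff linear_extension_sum linear_extension_of_bool_mult)
  then show ?thesis by (simp only: sum_derivation_gen_u_prod[OF len(1)] sum_derivation_gen_u_prod[OF len(2)])
qed

lemma counit_relation_poly:
  fixes j g :: "'n::finite list"
  assumes p: "partition_on (points (length c) (length d)) p"
    and len: "length g = length c" "length j = length d"
  shows "counit (relation_poly c d p j g) = 0"
proof -
  let ?Z = "\<lambda>g j. of_bool (constant_on_blocks p (diamond g j)) :: complex"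
  have "counit (relation_poly c d p j g) =
    (\<Sum>i | length i = length d. ?Z g i * counit (gen_u_prod d j i)) -
    (\<Sum>h | length h = length c. ?Z h j * counit (gen_u_prod c h g))"
    unfolding relation_poly_def Let_def zeta_kernel[OF p] counit_def
    by (simp only: linear_extension_diff linear_extension_sum linear_extension_of_bool_mult)
  also have "(\<Sum>i | length i = length d. ?Z g i * counit (gen_u_prod d j i)) = (\<Sum>i | length i = length d. if j = i then ?Z g j else 0)"
    by (intro sum.cong refl) (simp add: counit_gen_u_prod len)
  also have "\<dots> = ?Z g j" by (subst sum.delta'[OF finite_lists]) (simp add: len)
  also have "(\<Sum>h | length h = length c. ?Z h j * counit (gen_u_prod c h g)) = (\<Sum>h | length h = length c. if h = g then ?Z g j else 0)"
    by (intro sum.cong refl) (simp add: counit_gen_u_prod len)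
  also have "\<dots> = ?Z g j" by (subst sum.delta[OF finite_lists]) (simp add: len)
  finally show ?thesis by simp
qed

text \<open>The pair partitions force the matrix of the black generators to be minus the transpose
  of the one of the white generators.\<close>

definition matrix_values :: "complex^'n^'n \<Rightarrow> color \<Rightarrow> 'n \<Rightarrow> 'n \<Rightarrow> complex" where
  "matrix_values v x j i = (if x = White then v $ j $ i else - v $ i $ j)"

lemma constant_on_blocks_cong:
  assumes "partition_on X p" "\<And>P. P \<in> X \<Longrightarrow> f P = f' P"
  shows "constant_on_blocks p f \<longleftrightarrow> constant_on_blocks p f'"
proof -
  have "B \<subseteq> X" if "B \<in> p" for B using partition_onD1[OF assms(1)] that by auto
  then show ?thesis unfolding constant_on_blocks_def using assms(2) by (intro ball_cong refl) (metis subsetD)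
qed

lemma defect_cong:
  assumes "partition_on X p" "\<And>P. P \<in> X \<Longrightarrow> f P = f' P"
  shows "defect v X pos p f = defect v X pos p f'"
  unfolding defect_def
proof (intro sum.cong refl)
  fix P x assume "P \<in> X"
  moreover have "constant_on_blocks p (f(P := x)) \<longleftrightarrow> constant_on_blocks p (f'(P := x))"
    by (rule constant_on_blocks_cong[OF assms(1)]) (simp add: assms(2))
  ultimately show "of_bool (constant_on_blocks p (f(P := x))) * weight v pos P (f P) x =
    of_bool (constant_on_blocks p (f'(P := x))) * weight v pos P (f' P) x"
    by (simp add: assms(2))
qed

lemma sum_points:
  "(\<Sum>P\<in>points k l. h P) = (\<Sum>s<l. h (Lo (Suc s))) + (\<Sum>s<k. h (Up (Suc s)))"
proof -
  have "(\<Sum>P\<in>points k l. h P) = (\<Sum>P\<in>Up ` {1..k}. h P) + (\<Sum>P\<in>Lo ` {1..l}. h P)"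
    unfolding points_def by (rule sum.union_disjoint) auto
  also have "(\<Sum>P\<in>Up ` {1..k}. h P) = (\<Sum>s<k. h (Up (Suc s)))"
    by (subst sum.reindex) (auto simp: sum.atLeast1_atMost_eq intro!: inj_onI)
  also have "(\<Sum>P\<in>Lo ` {1..l}. h P) = (\<Sum>s<l. h (Lo (Suc s)))"
    by (subst sum.reindex) (auto simp: sum.atLeast1_atMost_eq intro!: inj_onI)
  finally show ?thesis by (simp only: add.commute)
qed

lemma derivation_relation_poly_defect:
  fixes j g :: "'n::finite list"
  assumes p: "partition_on (points (length c) (length d)) p"
    and len: "length g = length c" "length j = length d"
  shows "derivation (matrix_values v) (relation_poly c d p j g) =
    defect v (points (length c) (length d)) (white_lower_black_upper c d) p (diamond g j)"
proof -
  let ?pos = "white_lower_black_upper c d"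
  have color: "x = Black \<longleftrightarrow> x \<noteq> White" for x by (cases x) auto
  have lower: "of_bool (constant_on_blocks p (diamond g (j[s := x]))) * matrix_values v (d ! s) (j ! s) x =
     of_bool (constant_on_blocks p ((diamond g j)(Lo (Suc s) := x))) *
     weight v ?pos (Lo (Suc s)) (diamond g j (Lo (Suc s))) x" if s: "s < length d" for s x
  proof -
    have "constant_on_blocks p (diamond g (j[s := x])) \<longleftrightarrow>
        constant_on_blocks p ((diamond g j)(Lo (Suc s) := x))"
    proof (rule constant_on_blocks_cong[OF p])
      fix P assume P: "P \<in> points (length c) (length d)"
      show "diamond g (j[s := x]) P = ((diamond g j)(Lo (Suc s) := x)) P"
        using P s len by (cases P) (auto simp: points_def nth_list_update)
    qed
    moreover have "Lo (Suc s) \<in> ?pos \<longleftrightarrow> d ! s = White"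
      using s by (auto simp: white_lower_black_upper_def)
    ultimately show ?thesis by (simp add: matrix_values_def weight_def)
  qed
  have upper: "of_bool (constant_on_blocks p (diamond (g[s := x]) j)) * - matrix_values v (c ! s) x (g ! s) =
     of_bool (constant_on_blocks p ((diamond g j)(Up (Suc s) := x))) *
     weight v ?pos (Up (Suc s)) (diamond g j (Up (Suc s))) x" if s: "s < length c" for s x
  proof -
    have "constant_on_blocks p (diamond (g[s := x]) j) \<longleftrightarrow>
        constant_on_blocks p ((diamond g j)(Up (Suc s) := x))"
    proof (rule constant_on_blocks_cong[OF p])
      fix P assume P: "P \<in> points (length c) (length d)"
      show "diamond (g[s := x]) j P = ((diamond g j)(Up (Suc s) := x)) P"
        using P s len by (cases P) (auto simp: points_def nth_list_update)
    qed
    moreover have "Up (Suc s) \<in> ?pos \<longleftrightarrow> c ! s \<noteq> White"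
      using s by (auto simp: white_lower_black_upper_def color)
    ultimately show ?thesis by (simp add: matrix_values_def weight_def)
  qed
  have "defect v (points (length c) (length d)) ?pos p (diamond g j) =
    (\<Sum>s<length d. \<Sum>x\<in>UNIV. of_bool (constant_on_blocks p (diamond g (j[s := x]))) * matrix_values v (d ! s) (j ! s) x) +
    (\<Sum>s<length c. \<Sum>x\<in>UNIV. of_bool (constant_on_blocks p (diamond (g[s := x]) j)) * - matrix_values v (c ! s) x (g ! s))"
    unfolding defect_def sum_points using lower upper
    by (intro arg_cong2[where f = "(+)"] sum.cong refl) (simp_all only: lessThan_iff)
  then show ?thesis unfolding derivation_relation_poly[OF p len] by (simp add: sum_negf)
qed

section \<open>Dimensions of spaces of matrices\<close>

definition basis_size :: "(complex^'n^'n) set \<Rightarrow> nat \<Rightarrow> bool" where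
  "basis_size W m \<longleftrightarrow> cmat.subspace W \<and>
     (\<exists>B. finite B \<and> B \<subseteq> W \<and> cmat.independent B \<and> W \<subseteq> cmat.span B \<and> card B = m)"

lemma cmat_scale_nth [simp]: "cmat_scale z v $ j $ i = z * v $ j $ i"
  by (simp add: cmat_scale_def)

text \<open>A subspace whose elements are freely parametrized by their entries at the positions in
  \<open>S\<close> has the elements with a single non-zero entry there as a basis.\<close>

lemma basis_size_coordinates:
  fixes W :: "(complex^'n^'n) set" and S :: "('n \<times> 'n) set"
  assumes W: "cmat.subspace W"
    and fin: "finite S"
    and E: "\<And>s. s \<in> S \<Longrightarrow> E s \<in> W"
    and coord: "\<And>s j i. s \<in> S \<Longrightarrow> (j, i) \<in> S \<Longrightarrow> E s $ j $ i = of_bool (s = (j, i))"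
    and determined: "\<And>v. v \<in> W \<Longrightarrow> (\<And>j i. (j, i) \<in> S \<Longrightarrow> v $ j $ i = 0) \<Longrightarrow> v = 0"
  shows "basis_size W (card S)"
proof -
  have entry: "(\<Sum>s\<in>S. cmat_scale (f s) (E s)) $ j $ i = f (j, i)" if "(j, i) \<in> S" for f j i
  proof -
    have "(\<Sum>s\<in>S. cmat_scale (f s) (E s)) $ j $ i = (\<Sum>s\<in>S. f s * of_bool (s = (j, i)))"
      using coord that by (simp add: sum_component)
    also have "\<dots> = f (j, i)" using fin that by (simp add: of_bool_def if_distrib sum.delta cong: if_cong)
    finally show ?thesis .
  qed
  have inj: "inj_on E S"
  proof (rule inj_onI)
    fix s t assume st: "s \<in> S" "t \<in> S" "E s = E t"
    obtain j i where t: "t = (j, i)" by (cases t)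
    have "of_bool (s = t) = (1 :: complex)"
      using coord[of s j i] coord[of t j i] st unfolding t by simp
    then show "s = t" by (simp split: if_splits)
  qed
  have "cmat.independent (E ` S)"
  proof (rule cmat.independent_if_scalars_zero)
    show "finite (E ` S)" using fin by simp
    fix f x assume z: "(\<Sum>x\<in>E ` S. cmat_scale (f x) x) = 0" and "x \<in> E ` S"
    then obtain j i where s: "(j, i) \<in> S" "x = E (j, i)" by auto
    have "(\<Sum>s\<in>S. cmat_scale (f (E s)) (E s)) = 0"
      using z by (simp add: sum.reindex[OF inj] o_def)
    then show "f x = 0" using entry[OF s(1), of "\<lambda>s. f (E s)"] s(2) by simp
  qed
  moreover have "W \<subseteq> cmat.span (E ` S)"
  proof
    fix v assume v: "v \<in> W"
    let ?u = "\<Sum>s\<in>S. cmat_scale (v $ fst s $ snd s) (E s)"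
    have u: "?u \<in> W" by (intro cmat.subspace_sum[OF W] cmat.subspace_scale[OF W] E)
    have "v - ?u = 0"
    proof (rule determined[OF cmat.subspace_diff[OF W v u]])
      fix j i assume "(j, i) \<in> S"
      from entry[OF this, of "\<lambda>s. v $ fst s $ snd s"] show "(v - ?u) $ j $ i = 0"
        by (simp only: vector_minus_component) simp
    qed
    then have "v = ?u" by simp
    moreover have "?u \<in> cmat.span (E ` S)"
      by (intro cmat.span_sum cmat.span_scale cmat.span_base imageI)
    ultimately show "v \<in> cmat.span (E ` S)" by simp
  qed
  moreover have "card (E ` S) = card S" by (rule card_image[OF inj])
  ultimately show ?thesis unfolding basis_size_def using W fin E
    by (intro conjI exI[of _ "E ` S"]) auto
qed

lemma basis_size_dim: "basis_size W m \<Longrightarrow> cmat.dim W = m"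
  unfolding basis_size_def by (auto intro: cmat.dim_unique)

text \<open>Turns scalar matrices into multiples of one fixed vector, as spans require.\<close>

lemma mat_eq_scale: "mat z = cmat_scale z (mat 1 :: complex^'n^'n)"
  by (simp add: vec_eq_iff mat_def)

lemma basis_size_plus_scalars:
  assumes W: "basis_size {v :: complex^'n^'n. P v} m" and I: "\<not> P (mat 1)"
  shows "basis_size {v. \<exists>z. P (v - mat z)} (m + 1)"
proof -
  let ?W = "{v. P v}" and ?V = "{v :: complex^'n^'n. \<exists>z. P (v - mat z)}"
  obtain B where B: "finite B" "B \<subseteq> ?W" "cmat.independent B" "?W \<subseteq> cmat.span B" "card B = m"
    and sub: "cmat.subspace ?W"
    using W unfolding basis_size_def by auto
  have "cmat.span B \<subseteq> ?W" by (rule cmat.span_minimal[OF B(2) sub])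
  then have nI: "mat 1 \<notin> cmat.span B" using I by auto
  have P0: "P 0" using cmat.subspace_0[OF sub] by simp
  have Padd: "P u \<Longrightarrow> P v \<Longrightarrow> P (u + v)" for u v using cmat.subspace_add[OF sub] by simp
  have Pscale: "P u \<Longrightarrow> P (cmat_scale z u)" for u z using cmat.subspace_scale[OF sub] by simp
  have subV: "cmat.subspace ?V"
  proof (rule cmat.subspaceI)
    show "0 \<in> ?V" using P0 by (auto intro!: exI[of _ 0] simp: mat_eq_scale[of 0])
  next
    fix u v assume "u \<in> ?V" "v \<in> ?V"
    then obtain y z where "P (u - mat y)" "P (v - mat z)" by auto
    then have "P ((u - mat y) + (v - mat z))" by (rule Padd)
    moreover have "(u - mat y) + (v - mat z) = (u + v) - mat (y + z)"
      by (simp add: vec_eq_iff mat_def)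
    ultimately show "u + v \<in> ?V" by auto
  next
    fix c u assume "u \<in> ?V"
    then obtain y where "P (u - mat y)" by auto
    then have "P (cmat_scale c (u - mat y))" by (rule Pscale)
    moreover have "cmat_scale c (u - mat y) = cmat_scale c u - mat (c * y)"
      by (simp add: vec_eq_iff mat_def algebra_simps)
    ultimately show "cmat_scale c u \<in> ?V" by auto
  qed
  have "insert (mat 1) B \<subseteq> ?V"
  proof
    fix v assume "v \<in> insert (mat 1) B"
    then have "P (v - mat 1) \<or> P (v - mat 0)"
      using B(2) P0 by (auto simp: mat_eq_scale[of 0])
    then show "v \<in> ?V" by blast
  qed
  moreover have "?V \<subseteq> cmat.span (insert (mat 1) B)"
  proof
    fix v assume "v \<in> ?V"
    then obtain z where "v - mat z \<in> cmat.span B" using B(4) by auto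
    then have "v - cmat_scale z (mat 1) \<in> cmat.span B" by (simp only: mat_eq_scale[of z])
    then show "v \<in> cmat.span (insert (mat 1) B)" by (auto simp: cmat.span_insert)
  qed
  moreover have "mat 1 \<notin> B" using nI cmat.span_base by auto
  ultimately show ?thesis unfolding basis_size_def using subV B cmat.independent_insertI[OF nI B(3)]
    by (intro conjI exI[of _ "insert (mat 1) B"]) auto
qed

lemma basis_size_all: "basis_size {v :: complex^'n^'n. True} (CARD('n) ^ 2)"
proof -
  have "basis_size {v :: complex^'n^'n. True} (card (UNIV :: ('n \<times> 'n) set))"
    by (rule basis_size_coordinates[where E = "\<lambda>s. \<chi> j i. of_bool (s = (j, i))"])
      (auto simp: vec_eq_iff cmat.subspace_def)
  then show ?thesis by (simp add: card_prod power2_eq_square)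
qed

lemma basis_size_diagonal: "basis_size {v :: complex^'n^'n. diagonal_matrix v} (CARD('n))"
proof -
  let ?S = "range (\<lambda>j :: 'n. (j, j))"
  let ?E = "\<lambda>s. \<chi> j i. of_bool (s = (j, i))"
  have "basis_size {v :: complex^'n^'n. diagonal_matrix v} (card ?S)"
  proof (rule basis_size_coordinates[where E = ?E])
    show "v = 0" if "v \<in> {v. diagonal_matrix v}" "\<And>j i. (j, i) \<in> ?S \<Longrightarrow> v $ j $ i = 0" for v :: "complex^'n^'n"
    proof -
      have "v $ j $ i = 0" for j i
        using that by (cases "j = i") (simp_all add: diagonal_matrix_def)
      then show ?thesis by (simp add: vec_eq_iff)
    qed
  qed (auto simp: cmat.subspace_def diagonal_matrix_def)
  moreover have "card ?S = CARD('n)" by (intro card_image injI) simp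
  ultimately show ?thesis by simp
qed

lemma basis_size_zero: "basis_size {v :: complex^'n^'n. v = 0} 0"
proof -
  have "basis_size {v :: complex^'n^'n. v = 0} (card ({} :: ('n \<times> 'n) set))"
    by (rule basis_size_coordinates[where E = "\<lambda>_. 0"]) (auto simp: cmat.subspace_def)
  then show ?thesis by simp
qed

lemma subspace_small: "cmat.subspace {v :: complex^'n^'n. small v}"
  by (rule cmat.subspaceI) (simp_all add: small_def sum.distrib flip: sum_distrib_left)

lemma skew_symmetric_iff: "skew_symmetric v \<longleftrightarrow> (\<forall>j i. v $ j $ i = - v $ i $ j)"
  by (simp add: skew_symmetric_def vec_eq_iff transpose_def)

lemma subspace_skew: "cmat.subspace {v :: complex^'n^'n. skew_symmetric v}"
proof (rule cmat.subspaceI)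
  fix u v :: "complex^'n^'n" and c
  assume u: "u \<in> {v. skew_symmetric v}"
  have u': "u $ j $ i = - u $ i $ j" for j i using u unfolding mem_Collect_eq skew_symmetric_iff by blast
  show "cmat_scale c u \<in> {v. skew_symmetric v}"
    unfolding mem_Collect_eq skew_symmetric_iff
  proof (intro allI)
    fix j i show "cmat_scale c u $ j $ i = - cmat_scale c u $ i $ j" using u'[of j i] by simp
  qed
  assume v: "v \<in> {v. skew_symmetric v}"
  have v': "v $ j $ i = - v $ i $ j" for j i using v unfolding mem_Collect_eq skew_symmetric_iff by blast
  show "u + v \<in> {v. skew_symmetric v}"
    unfolding mem_Collect_eq skew_symmetric_iff
  proof (intro allI)
    fix j i show "(u + v) $ j $ i = - (u + v) $ i $ j" using u'[of j i] v'[of j i] by simp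
  qed
qed (simp add: skew_symmetric_iff)

text \<open>The difference of the unit vectors at \<open>i\<close> and \<open>i0\<close>. Products
  of two such vectors are small matrices, and their entries away from \<open>i0\<close> are those
  of a matrix unit.\<close>

definition edge :: "'n \<Rightarrow> 'n \<Rightarrow> 'n \<Rightarrow> complex" where
  "edge i0 i a = of_bool (a = i) - of_bool (a = i0)"

lemma sum_edge: "(\<Sum>a\<in>(UNIV :: 'n::finite set). edge i0 i a) = 0"
  by (simp add: edge_def sum_subtractf of_bool_def sum.delta)

lemma sum_eq_single: "(\<And>j. j \<noteq> i0 \<Longrightarrow> f j = 0) \<Longrightarrow> (\<Sum>j\<in>(UNIV :: 'n::finite set). f j) = (f i0 :: complex)"
  by (subst sum.remove[of _ i0]) auto

lemma small_determined:
  fixes v :: "complex^'n^'n"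
  assumes "small v" and z: "\<And>j i. j \<noteq> i0 \<Longrightarrow> i \<noteq> i0 \<Longrightarrow> v $ j $ i = 0"
  shows "v = 0"
proof -
  have row: "(\<Sum>i\<in>UNIV. v $ j $ i) = 0" and col: "(\<Sum>j\<in>UNIV. v $ j $ i) = 0" for j i
    using assms(1) by (simp_all add: small_def)
  have 1: "v $ j $ i0 = 0" if "j \<noteq> i0" for j
  proof -
    have "(\<Sum>i\<in>UNIV. v $ j $ i) = v $ j $ i0" by (rule sum_eq_single) (rule z[OF that])
    then show ?thesis unfolding row by simp
  qed
  have 2: "v $ i0 $ i = 0" if "i \<noteq> i0" for i
  proof -
    have "(\<Sum>j\<in>UNIV. v $ j $ i) = v $ i0 $ i" by (rule sum_eq_single) (rule z[OF _ that])
    then show ?thesis unfolding col by simp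
  qed
  have 3: "v $ i0 $ i0 = 0"
  proof -
    have "(\<Sum>i\<in>UNIV. v $ i0 $ i) = v $ i0 $ i0" by (rule sum_eq_single) (rule 2)
    then show ?thesis unfolding row by simp
  qed
  have "v $ j $ i = 0" for j i
    by (cases "j = i0"; cases "i = i0") (use z 1 2 3 in blast)+
  then show ?thesis by (simp add: vec_eq_iff)
qed

lemma basis_size_small: "basis_size {v :: complex^'n^'n. small v} ((CARD('n) - 1) ^ 2)"
proof -
  obtain i0 :: 'n where True by auto
  let ?S = "(UNIV - {i0}) \<times> (UNIV - {i0})"
  let ?E = "\<lambda>s. \<chi> a b. edge i0 (fst s) a * edge i0 (snd s) b"
  have "basis_size {v :: complex^'n^'n. small v} (card ?S)"
  proof (rule basis_size_coordinates[where E = ?E])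
    show "?E s \<in> {v. small v}" for s
      by (simp add: small_def sum_distrib_left[symmetric] sum_distrib_right[symmetric] sum_edge)
    show "?E s $ j $ i = of_bool (s = (j, i))" if "s \<in> ?S" "(j, i) \<in> ?S" for s j i
      using that by (auto simp: edge_def)
    show "v = 0" if "v \<in> {v. small v}" "\<And>j i. (j, i) \<in> ?S \<Longrightarrow> v $ j $ i = 0" for v :: "complex^'n^'n"
      using that by (intro small_determined[of v i0]) simp_all
  qed (simp_all add: subspace_small)
  then show ?thesis by (simp add: card_cartesian_product power2_eq_square)
qed

lemma card_ordered_pairs:
  fixes r :: "'a \<Rightarrow> nat"
  assumes "finite T" "inj r"
  shows "real (card {(i, j). i \<in> T \<and> j \<in> T \<and> r i < r j}) = real (card T) * (real (card T) - 1) / 2"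
proof -
  let ?L = "{(i, j). i \<in> T \<and> j \<in> T \<and> r i < r j}"
  let ?D = "(\<lambda>i. (i, i)) ` T"
  have fin: "finite ?L" by (rule finite_subset[of _ "T \<times> T"]) (use assms in auto)
  have split: "T \<times> T = ?D \<union> (?L \<union> prod.swap ` ?L)"
  proof (intro equalityI subsetI)
    fix x assume "x \<in> T \<times> T"
    then obtain i j where x: "x = (i, j)" "i \<in> T" "j \<in> T" by auto
    consider "i = j" | "r i < r j" | "r j < r i" using assms(2) by (metis injD linorder_neqE_nat)
    then show "x \<in> ?D \<union> (?L \<union> prod.swap ` ?L)"
    proof cases
      case 3
      then have "prod.swap (j, i) \<in> prod.swap ` ?L" using x by (intro imageI) auto
      then show ?thesis using x by simp
    qed (use x in auto)
  qed auto
  have disj: "?D \<inter> (?L \<union> prod.swap ` ?L) = {}" "?L \<inter> prod.swap ` ?L = {}" by auto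
  have "card (T \<times> T) = card ?D + card (?L \<union> prod.swap ` ?L)"
    unfolding split by (rule card_Un_disjoint[OF _ _ disj(1)]) (simp_all add: fin assms(1))
  also have "card (?L \<union> prod.swap ` ?L) = card ?L + card (prod.swap ` ?L)"
    by (rule card_Un_disjoint[OF fin _ disj(2)]) (simp add: fin)
  finally have "card (T \<times> T) = card ?D + (card ?L + card (prod.swap ` ?L))" .
  moreover have "card ?D = card T" by (intro card_image inj_onI) simp
  moreover have "card (prod.swap ` ?L) = card ?L" by (rule card_image) (simp add: inj_on_def)
  ultimately have "card T * card T = card T + 2 * card ?L" by (simp add: card_cartesian_product)
  from arg_cong[OF this, of real]
  have "real (card T) * real (card T) = real (card T) + 2 * real (card ?L)"
    by (simp only: of_nat_add of_nat_mult of_nat_numeral)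
  then show ?thesis by (simp add: algebra_simps)
qed

lemma ex_inj_nat: "\<exists>r :: 'n::finite \<Rightarrow> nat. inj r"
  using finite_imp_inj_to_nat_seg[of "UNIV :: 'n set"] by auto

lemma skew_determined:
  fixes v :: "complex^'n^'n" and r :: "'n \<Rightarrow> nat"
  assumes "skew_symmetric v" "inj r" and z: "\<And>j i. j \<in> T \<Longrightarrow> i \<in> T \<Longrightarrow> r j < r i \<Longrightarrow> v $ j $ i = 0"
    and "j \<in> T" "i \<in> T"
  shows "v $ j $ i = 0"
proof -
  have s: "v $ j $ i = - v $ i $ j" for j i using assms(1) skew_symmetric_iff by auto
  consider "r j < r i" | "r i < r j" | "j = i" using assms(2) by (metis injD linorder_neqE_nat)
  then show ?thesis
    by cases (use z assms(4,5) s[of j i] s[of i i] in auto)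
qed

lemma basis_size_skew:
  "\<exists>m. basis_size {v :: complex^'n^'n. skew_symmetric v} m \<and>
     real m = 1 / 2 * real CARD('n) * (real CARD('n) - 1)"
proof -
  obtain r :: "'n \<Rightarrow> nat" where r: "inj r" using ex_inj_nat by blast
  let ?S = "{(i, j). i \<in> UNIV \<and> j \<in> UNIV \<and> r i < r j}"
  let ?E = "\<lambda>s. \<chi> a b. (of_bool (s = (a, b)) - of_bool (s = (b, a)) :: complex)"
  have "basis_size {v :: complex^'n^'n. skew_symmetric v} (card ?S)"
  proof (rule basis_size_coordinates[where E = ?E])
    show "?E s \<in> {v. skew_symmetric v}" for s by (simp add: skew_symmetric_iff)
    show "?E s $ j $ i = of_bool (s = (j, i))" if "s \<in> ?S" "(j, i) \<in> ?S" for s j i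
    proof -
      have "s \<noteq> (i, j)" using that by auto
      then show ?thesis by simp
    qed
    show "v = 0" if "v \<in> {v. skew_symmetric v}" "\<And>j i. (j, i) \<in> ?S \<Longrightarrow> v $ j $ i = 0" for v :: "complex^'n^'n"
      using skew_determined[of v r UNIV] that r by (simp add: vec_eq_iff)
  qed (simp_all add: subspace_skew)
  then show ?thesis using card_ordered_pairs[of UNIV r] r by auto
qed

lemma basis_size_skew_small:
  "\<exists>m. basis_size {v :: complex^'n^'n. skew_symmetric v \<and> small v} m \<and>
     real m = 1 / 2 * (real CARD('n) - 1) * (real CARD('n) - 2)"
proof -
  obtain r :: "'n \<Rightarrow> nat" where r: "inj r" using ex_inj_nat by blast
  obtain i0 :: 'n where True by auto
  let ?S = "{(i, j). i \<in> UNIV - {i0} \<and> j \<in> UNIV - {i0} \<and> r i < r j}"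
  \<comment> \<open>the antisymmetrization of the basis used for small matrices\<close>
  let ?E = "\<lambda>s. \<chi> a b. edge i0 (fst s) a * edge i0 (snd s) b - edge i0 (snd s) a * edge i0 (fst s) b"
  have "basis_size {v :: complex^'n^'n. skew_symmetric v \<and> small v} (card ?S)"
  proof (rule basis_size_coordinates[where E = ?E])
    show "cmat.subspace {v :: complex^'n^'n. skew_symmetric v \<and> small v}"
      using cmat.subspace_inter[OF subspace_skew subspace_small] by (simp add: Int_def)
    show "?E s \<in> {v. skew_symmetric v \<and> small v}" for s
      by (simp add: small_def skew_symmetric_iff sum_subtractf
          sum_distrib_left[symmetric] sum_distrib_right[symmetric] sum_edge)
    show "?E s $ j $ i = of_bool (s = (j, i))" if "s \<in> ?S" "(j, i) \<in> ?S" for s j i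
      using that by (auto simp: edge_def)
    show "v = 0" if "v \<in> {v. skew_symmetric v \<and> small v}" "\<And>j i. (j, i) \<in> ?S \<Longrightarrow> v $ j $ i = 0"
      for v :: "complex^'n^'n"
      using skew_determined[of v r "UNIV - {i0}"] small_determined[of v i0] that r by simp
  qed simp_all
  moreover have "real (card ?S) = 1 / 2 * (real CARD('n) - 1) * (real CARD('n) - 2)"
    using card_ordered_pairs[of "UNIV - {i0}" r] r by (simp add: of_nat_diff)
  ultimately show ?thesis by blast
qed

section \<open>Cocycles of the quotient algebra\<close>

lemma derivation_add: "derivation \<theta> (f + g) = derivation \<theta> f + derivation \<theta> g"
  by (simp add: derivation_def linear_extension_add)

lemma derivation_diff: "derivation \<theta> (f - g) = derivation \<theta> f - derivation \<theta> g"
  by (simp add: derivation_def linear_extension_diff)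

lemma counit_add: "counit (f + g) = counit f + counit g"
  by (simp add: counit_def linear_extension_add)

lemma counit_diff: "counit (f - g) = counit f - counit g"
  by (simp add: counit_def linear_extension_diff)

lemma counit_scalar [simp]: "counit (Poly_Mapping.single 0 a) = a"
  by (simp add: counit_def zero_free_monoid_def)

lemma derivation_scalar [simp]: "derivation \<theta> (Poly_Mapping.single 0 a) = 0"
  by (simp add: derivation_def zero_free_monoid_def)

lemma counit_one [simp]: "counit 1 = 1"
  using counit_scalar[of 1] by simp

lemma carrier_free [simp]: "carrier free_algebra = UNIV"
  and mult_free [simp]: "mult free_algebra = (*)"
  and one_free [simp]: "one free_algebra = 1"
  and zero_free [simp]: "zero free_algebra = 0"
  and add_free [simp]: "add free_algebra = (+)"
  by (simp_all add: free_algebra_def)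

lemma ring_free_algebra: "ring (free_algebra :: (complex, 'n poly_alg) module)"
proof (rule ringI)
  show "abelian_group (free_algebra :: (complex, 'n poly_alg) module)"
  proof (rule abelian_groupI)
    fix x :: "'n poly_alg" assume "x \<in> carrier free_algebra"
    show "\<exists>y\<in>carrier free_algebra. y \<oplus>\<^bsub>free_algebra\<^esub> x = \<zero>\<^bsub>free_algebra\<^esub>"
      by (rule bexI[of _ "- x"]) simp_all
  qed (simp_all add: algebra_simps)
  show "monoid (free_algebra :: (complex, 'n poly_alg) module)"
    by (rule monoidI) (simp_all add: algebra_simps)
qed (simp_all add: algebra_simps)

text \<open>The kernel of a derivation is no ideal, but by the product rule its intersection with
  the kernel of the counit is one.\<close>

lemma ideal_kernel:
  "ideal {f. counit f = 0 \<and> derivation \<theta> f = 0} (free_algebra :: (complex, 'n poly_alg) module)"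
proof (rule idealI[OF ring_free_algebra])
  let ?K = "{f :: 'n poly_alg. counit f = 0 \<and> derivation \<theta> f = 0}"
  interpret ring "free_algebra :: (complex, 'n poly_alg) module" by (rule ring_free_algebra)
  show "subgroup ?K (add_monoid (free_algebra :: (complex, 'n poly_alg) module))"
  proof (rule add.subgroupI)
    show "?K \<noteq> {}" by (auto intro!: exI[of _ 0] simp: counit_def derivation_def)
    fix f :: "'n poly_alg" assume f: "f \<in> ?K"
    have "\<ominus>\<^bsub>free_algebra\<^esub> f = - f" by (rule minus_equality) simp_all
    moreover have "- f \<in> ?K" using f by (simp add: counit_def derivation_def linear_extension_uminus)
    ultimately show "\<ominus>\<^bsub>free_algebra\<^esub> f \<in> ?K" by simp
  qed (simp_all add: counit_add derivation_add)
qed (simp_all add: counit_mult derivation_mult)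

text \<open>Applied to the zero matrix, the statements about solutions yield those about the
  counit.\<close>

lemma zero_solution: "(0 :: complex^'a^'a) \<in> solutions C"
proof -
  have "weight 0 pos P a x = 0" for pos and P :: point and a x :: 'a
    by (simp add: weight_def)
  then show ?thesis by (simp add: solutions_def defect_def)
qed

definition coset :: "tcp set \<Rightarrow> 'n::finite poly_alg \<Rightarrow> 'n poly_alg set" where
  "coset C f = a_r_coset free_algebra (relation_ideal C) f"

text \<open>The functional that \<open>F\<close> induces on the quotient, provided that
  \<open>F\<close> vanishes on the ideal. It is zero outside the carrier, as functionals on an
  algebra are required to be.\<close>

definition lift_functional ::
    "tcp set \<Rightarrow> ('n::finite poly_alg \<Rightarrow> complex) \<Rightarrow> 'n poly_alg set \<Rightarrow> complex" where
  "lift_functional C F X = (if X \<in> range (coset C) then F (SOME f. coset C f = X) else 0)"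

context
  fixes C :: "tcp set"
  assumes category: "partition_category C"
begin

lemma ideal_relations: "ideal (relation_ideal C) (free_algebra :: (complex, 'n::finite poly_alg) module)"
  unfolding relation_ideal_def using ring.genideal_ideal[OF ring_free_algebra] by simp

lemma relations_in_ideal: "relations C \<subseteq> (relation_ideal C :: 'n::finite poly_alg set)"
  unfolding relation_ideal_def using ring.genideal_self[OF ring_free_algebra] by simp

lemma relation_ideal_closed:
  fixes f g h :: "'n::finite poly_alg"
  shows "0 \<in> (relation_ideal C :: 'n poly_alg set)"
    and "f \<in> relation_ideal C \<Longrightarrow> g \<in> relation_ideal C \<Longrightarrow> f + g \<in> relation_ideal C"
    and "f \<in> relation_ideal C \<Longrightarrow> h * f \<in> relation_ideal C"
  using additive_subgroup.zero_closed[OF ideal.axioms(1)[OF ideal_relations]]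
    additive_subgroup.a_closed[OF ideal.axioms(1)[OF ideal_relations], of f g]
    ideal.I_l_closed[OF ideal_relations, of f h] by simp_all

lemma in_coset_iff: "h \<in> coset C g \<longleftrightarrow> h - g \<in> (relation_ideal C :: 'n::finite poly_alg set)"
  by (auto simp: coset_def a_r_coset_def r_coset_def intro: bexI[of _ "h - g"])

lemma coset_self: "f \<in> coset C (f :: 'n::finite poly_alg)"
  by (simp add: in_coset_iff relation_ideal_closed(1))

lemma coset_eq_iff: "coset C f = coset C g \<longleftrightarrow> f - g \<in> (relation_ideal C :: 'n::finite poly_alg set)"
proof
  assume "coset C f = coset C g"
  then have "f \<in> coset C g" using coset_self[of f] by simp
  then show "f - g \<in> relation_ideal C" by (simp only: in_coset_iff)
next
  assume fg: "f - g \<in> relation_ideal C"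
  have "h - f \<in> relation_ideal C \<longleftrightarrow> h - g \<in> relation_ideal C" for h
  proof
    assume "h - f \<in> relation_ideal C"
    from relation_ideal_closed(2)[OF this fg] show "h - g \<in> relation_ideal C" by simp
  next
    assume "h - g \<in> relation_ideal C"
    from relation_ideal_closed(2)[OF this relation_ideal_closed(3)[OF fg, of "- 1"]]
    show "h - f \<in> relation_ideal C" by simp
  qed
  then show "coset C f = coset C g" by (intro Set.set_eqI) (simp only: in_coset_iff)
qed

lemma easy_algebra_carrier: "carrier (easy_algebra C) = range (coset C :: 'n::finite poly_alg \<Rightarrow> _)"
  by (auto simp: easy_algebra_def ring.defs module.defs FactRing_def A_RCOSETS_def RCOSETS_def coset_def a_r_coset_def)

lemma easy_algebra_add:
  "add (easy_algebra C) (coset C f) (coset C g) = coset C (f + g :: 'n::finite poly_alg)"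
proof -
  interpret ideal "relation_ideal C :: 'n poly_alg set" "free_algebra :: (complex, 'n poly_alg) module"
    by (rule ideal_relations)
  show ?thesis
    using a_rcos_sum[of f g] by (simp add: easy_algebra_def ring.defs module.defs FactRing_def coset_def)
qed

lemma easy_algebra_mult:
  "mult (easy_algebra C) (coset C f) (coset C g) = coset C (f * g :: 'n::finite poly_alg)"
proof -
  interpret ideal "relation_ideal C :: 'n poly_alg set" "free_algebra :: (complex, 'n poly_alg) module"
    by (rule ideal_relations)
  show ?thesis
    using rcoset_mult_add[of f g] by (simp add: easy_algebra_def ring.defs module.defs FactRing_def coset_def)
qed

lemma easy_algebra_one: "one (easy_algebra C) = coset C (1 :: 'n::finite poly_alg)"
  by (simp add: easy_algebra_def ring.defs module.defs FactRing_def coset_def)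

lemma easy_algebra_smult:
  "smult (easy_algebra C) a (coset C f) = coset C (Poly_Mapping.single 0 a * f :: 'n::finite poly_alg)"
proof -
  have "coset C (Poly_Mapping.single 0 a * g) = coset C (Poly_Mapping.single 0 a * f)"
    if "g \<in> coset C f" for g
  proof -
    have "g - f \<in> relation_ideal C" using that by (simp only: in_coset_iff)
    from relation_ideal_closed(3)[OF this, of "Poly_Mapping.single 0 a"]
    show ?thesis unfolding coset_eq_iff right_diff_distrib .
  qed
  then have "(\<Union>g\<in>coset C f. coset C (Poly_Mapping.single 0 a * g)) = coset C (Poly_Mapping.single 0 a * f)"
    using coset_self[of f] by blast
  then show ?thesis
    by (simp add: easy_algebra_def ring.defs module.defs coset_def) (simp add: free_algebra_def)
qed

lemma easy_u_eq: "easy_u C x j i = coset C (gen_u x j i)"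
  by (simp add: easy_u_def coset_def)

lemma lift_functional_coset:
  fixes F :: "'n::finite poly_alg \<Rightarrow> complex"
  assumes diff: "\<And>f g. F (f - g) = F f - F g" and zero: "\<And>f. f \<in> relation_ideal C \<Longrightarrow> F f = 0"
  shows "lift_functional C F (coset C f) = F f"
proof -
  let ?g = "SOME g. coset C g = coset C f"
  have "coset C ?g = coset C f" by (rule someI[of _ f]) simp
  then have "?g - f \<in> relation_ideal C" by (simp only: coset_eq_iff)
  then have "F (?g - f) = 0" by (rule zero)
  then show ?thesis unfolding lift_functional_def by (simp add: diff)
qed

lemma linear_functionals_coset:
  assumes "\<eta> \<in> linear_functionals (easy_algebra C)"
  shows "\<eta> (coset C (f + g)) = \<eta> (coset C f) + \<eta> (coset C (g :: 'n::finite poly_alg))"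
    and "\<eta> (coset C (Poly_Mapping.single 0 a * f)) = a * \<eta> (coset C f)"
    and "X \<notin> range (coset C) \<Longrightarrow> \<eta> X = 0"
  using assms unfolding linear_functionals_def easy_algebra_carrier
  by (auto simp: easy_algebra_add easy_algebra_smult)

lemma solution_kills_ideal:
  fixes v :: "complex^'n^'n"
  assumes v: "v \<in> solutions C" and f: "f \<in> relation_ideal C"
  shows "counit f = 0" "derivation (matrix_values v) f = 0"
proof -
  have "relations C \<subseteq> {f. counit f = 0 \<and> derivation (matrix_values v) f = 0}"
  proof
    fix r :: "'n poly_alg" assume "r \<in> relations C"
    then obtain c d p j g where r: "r = relation_poly c d p j g" "(c, d, p) \<in> C"
      "length g = length c" "length j = length d" unfolding relations_def by auto
    have p: "partition_on (points (length c) (length d)) p"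
      by (rule in_category_partition[OF category r(2)])
    have "defect v (points (length c) (length d)) (white_lower_black_upper c d) p (diamond g j) = 0"
      using v r(2) unfolding solutions_def by blast
    then show "r \<in> {f. counit f = 0 \<and> derivation (matrix_values v) f = 0}"
      using counit_relation_poly[OF p r(3,4)] derivation_relation_poly_defect[OF p r(3,4)] r(1) by simp
  qed
  from ring.genideal_minimal[OF ring_free_algebra ideal_kernel this] f
  have "f \<in> {f. counit f = 0 \<and> derivation (matrix_values v) f = 0}"
    unfolding relation_ideal_def by blast
  then show "counit f = 0" "derivation (matrix_values v) f = 0" by auto
qed

lemma lift_counit [simp]: "lift_functional C counit (coset C (f :: 'n::finite poly_alg)) = counit f"
  by (rule lift_functional_coset) (auto simp: counit_diff solution_kills_ideal(1)[OF zero_solution])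

lemma lift_derivation:
  fixes v :: "complex^'n^'n"
  assumes "v \<in> solutions C"
  shows "lift_functional C (derivation (matrix_values v)) (coset C f) = derivation (matrix_values v) f"
  by (rule lift_functional_coset) (auto simp: derivation_diff solution_kills_ideal(2)[OF assms])

lemma single_Letters_Cons:
  "(Poly_Mapping.single (Letters ((x, j, i) # w)) 1 :: 'n poly_alg)
     = gen_u x j i * Poly_Mapping.single (Letters w) 1"
  by (simp add: gen_u_def mult_single plus_free_monoid_def)

text \<open>A character is determined by its values on the letters, since these generate the free
  algebra.\<close>

lemma easy_counit_eq: "easy_counit C = lift_functional C (counit :: 'n::finite poly_alg \<Rightarrow> complex)"
  unfolding easy_counit_def
proof (rule the_equality)
  let ?e = "lift_functional C (counit :: 'n poly_alg \<Rightarrow> complex)"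
  have "?e \<in> linear_functionals (easy_algebra C)"
    unfolding linear_functionals_def easy_algebra_carrier
    by (auto simp: easy_algebra_add easy_algebra_smult counit_add counit_mult) (simp add: lift_functional_def)
  then have "?e \<in> characters (easy_algebra C)"
    unfolding characters_def easy_algebra_carrier
    by (auto simp: easy_algebra_one easy_algebra_mult counit_mult)
  then show "?e \<in> characters (easy_algebra C) \<and> (\<forall>x j i. ?e (easy_u C x j i) = of_bool (j = i))"
    by (simp add: easy_u_eq)
next
  fix e :: "'n poly_alg set \<Rightarrow> complex"
  assume e: "e \<in> characters (easy_algebra C) \<and> (\<forall>x j i. e (easy_u C x j i) = of_bool (j = i))"
  then have lin: "e \<in> linear_functionals (easy_algebra C)" by (simp add: characters_def)
  have one: "e (coset C 1) = 1"
    and mult: "e (coset C (f * g)) = e (coset C f) * e (coset C g)" for f g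
    using e unfolding characters_def easy_algebra_carrier by (auto simp: easy_algebra_one easy_algebra_mult)
  have gen: "e (coset C (gen_u x j i)) = of_bool (j = i)" for x j i using e by (simp add: easy_u_eq)
  have word: "e (coset C (Poly_Mapping.single (Letters w) 1)) = word_counit w" for w
  proof (induction w)
    case Nil
    show ?case using one by (simp add: zero_free_monoid_def[symmetric])
  next
    case (Cons l w)
    obtain x j i where l: "l = (x, j, i)" by (cases l)
    show ?case unfolding l single_Letters_Cons mult Cons gen by simp
  qed
  have coset: "e (coset C f) = counit f" for f
  proof (rule poly_additive_ext[of "\<lambda>f. e (coset C f)"])
    fix w a
    show "e (coset C (Poly_Mapping.single w a)) = counit (Poly_Mapping.single w a)"
      using word[of "letters w"] linear_functionals_coset(2)[OF lin, of a "Poly_Mapping.single w 1"]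
      by (simp add: counit_def mult_single)
  qed (rule linear_functionals_coset(1)[OF lin] counit_add)+
  show "e = lift_functional C counit"
  proof
    fix X
    show "e X = lift_functional C counit X"
    proof (cases "X \<in> range (coset C :: 'n poly_alg \<Rightarrow> _)")
      case True
      then show ?thesis using coset by auto
    next
      case False
      then show ?thesis using linear_functionals_coset(3)[OF lin] by (simp add: lift_functional_def)
    qed
  qed
qed

abbreviation cocycles :: "('n::finite poly_alg set \<Rightarrow> complex) set" where
  "cocycles \<equiv> cocycles1 (easy_algebra C) (easy_counit C)"

lemma cocycle_of_solution:
  fixes v :: "complex^'n^'n"
  assumes v: "v \<in> solutions C"
  shows "lift_functional C (derivation (matrix_values v)) \<in> cocycles"
    and "(\<chi> j i. lift_functional C (derivation (matrix_values v)) (easy_u C White j i)) = v"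
proof -
  let ?e = "lift_functional C (derivation (matrix_values v))"
  have "?e \<in> linear_functionals (easy_algebra C)"
    unfolding linear_functionals_def easy_algebra_carrier
    by (auto simp: easy_algebra_add easy_algebra_smult derivation_add derivation_mult lift_derivation[OF v])
      (simp add: lift_functional_def)
  then show "?e \<in> cocycles"
    unfolding cocycles1_def easy_algebra_carrier easy_counit_eq
    by (auto simp: easy_algebra_mult lift_derivation[OF v] derivation_mult)
  show "(\<chi> j i. ?e (easy_u C White j i)) = v"
    by (simp add: vec_eq_iff easy_u_eq lift_derivation[OF v] matrix_values_def)
qed

text \<open>Pulled back to the free algebra, a cocycle is a derivation over the counit, hence
  determined by its values on the letters. The relation of the cup expresses the black letters by
  the white ones, and the vanishing of the derivation on all other relations says that the matrix
  is a solution.\<close>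

lemma solution_of_cocycle:
  fixes \<eta> :: "'n::finite poly_alg set \<Rightarrow> complex"
  assumes \<eta>: "\<eta> \<in> cocycles"
  defines "v \<equiv> \<chi> j i. \<eta> (easy_u C White j i)"
  shows "v \<in> solutions C" and "\<eta> = lift_functional C (derivation (matrix_values v))"
proof -
  have lin: "\<eta> \<in> linear_functionals (easy_algebra C)" using \<eta> by (simp add: cocycles1_def)
  have mult: "\<eta> (coset C (f * g)) = counit f * \<eta> (coset C g) + \<eta> (coset C f) * counit g" for f g
    using \<eta> unfolding cocycles1_def easy_algebra_carrier easy_counit_eq by (auto simp: easy_algebra_mult)
  have one: "\<eta> (coset C 1) = 0" using mult[of 1 1] by simp
  define \<theta> where "\<theta> x j i = \<eta> (coset C (gen_u x j i))" for x j i
  have word: "\<eta> (coset C (Poly_Mapping.single (Letters w) 1)) = word_derivation \<theta> w" for w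
  proof (induction w)
    case Nil
    show ?case using one by (simp add: zero_free_monoid_def[symmetric])
  next
    case (Cons l w)
    obtain x j i where l: "l = (x, j, i)" by (cases l)
    have "counit (Poly_Mapping.single (Letters w) 1) = word_counit w" by (simp add: counit_def)
    moreover have "\<eta> (coset C (gen_u x j i)) = \<theta> x j i" by (simp only: \<theta>_def)
    ultimately show ?case unfolding l single_Letters_Cons mult Cons by simp
  qed
  have coset: "\<eta> (coset C f) = derivation \<theta> f" for f
  proof (rule poly_additive_ext[of "\<lambda>f. \<eta> (coset C f)"])
    fix w a
    show "\<eta> (coset C (Poly_Mapping.single w a)) = derivation \<theta> (Poly_Mapping.single w a)"
      using word[of "letters w"] linear_functionals_coset(2)[OF lin, of a "Poly_Mapping.single w 1"]
      by (simp add: derivation_def mult_single)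
  qed (rule linear_functionals_coset(1)[OF lin] derivation_add)+
  have relation: "derivation \<theta> r = 0" if "r \<in> relations C" for r
  proof -
    have "coset C r = coset C (0 :: 'n poly_alg)" using subsetD[OF relations_in_ideal that] by (simp add: coset_eq_iff)
    then have "derivation \<theta> r = derivation \<theta> 0" unfolding coset[symmetric] by simp
    then show ?thesis by (simp add: derivation_def)
  qed
  have black: "\<theta> Black b a = - \<theta> White a b" for a b
  proof -
    let ?p = "{{Lo 1, Lo 2}}"
    have cup: "([], [White, Black], ?p) \<in> C" using category_cup[OF category, of Black] by simp
    then have "relation_poly [] [White, Black] ?p [a, b] [] \<in> relations C"
      unfolding relations_def by force
    from relation[OF this] have "(\<Sum>s<2. \<Sum>x\<in>UNIV. of_bool (constant_on_blocks ?p (diamond [] ([a, b][s := x]))) *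
        \<theta> ([White, Black] ! s) ([a, b] ! s) x) = 0"
      by (subst (asm) derivation_relation_poly[OF in_category_partition[OF category cup]]) (simp_all add: numeral_2_eq_2)
    moreover have "constant_on_blocks ?p (diamond [] ([a, b][0 := x])) \<longleftrightarrow> x = b"
      "constant_on_blocks ?p (diamond [] ([a, b][1 := x])) \<longleftrightarrow> x = a" for x
      by (auto simp: constant_on_blocks_def)
    ultimately have "\<theta> White a b + \<theta> Black b a = 0"
      by (simp add: numeral_2_eq_2 of_bool_def if_distrib[of "\<lambda>c. c * _"] sum.delta cong: if_cong)
    then show ?thesis by (simp add: add_eq_0_iff)
  qed
  have \<theta>: "\<theta> = matrix_values v"
  proof (intro ext)
    fix x j i
    show "\<theta> x j i = matrix_values v x j i"
      by (cases x) (simp_all add: matrix_values_def v_def easy_u_eq black, simp_all add: \<theta>_def)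
  qed
  show v: "v \<in> solutions C"
    unfolding solutions_def
  proof (intro CollectI allI impI)
    fix c d p and f :: "point \<Rightarrow> 'n" assume p: "(c, d, p) \<in> C"
    let ?g = "map (\<lambda>s. f (Up (Suc s))) [0..<length c]" and ?j = "map (\<lambda>s. f (Lo (Suc s))) [0..<length d]"
    note part = in_category_partition[OF category p]
    have "relation_poly c d p ?j ?g \<in> relations C"
      unfolding relations_def using p by force
    then have "defect v (points (length c) (length d)) (white_lower_black_upper c d) p (diamond ?g ?j) = 0"
      using relation derivation_relation_poly_defect[OF part, of ?g ?j v] unfolding \<theta> by simp
    moreover have "f P = diamond ?g ?j P" if "P \<in> points (length c) (length d)" for P
      using that by (auto simp: points_def)
    ultimately show "defect v (points (length c) (length d)) (white_lower_black_upper c d) p f = 0"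
      using defect_cong[OF part] by metis
  qed
  show "\<eta> = lift_functional C (derivation (matrix_values v))"
  proof
    fix X
    show "\<eta> X = lift_functional C (derivation (matrix_values v)) X"
    proof (cases "X \<in> range (coset C :: 'n poly_alg \<Rightarrow> _)")
      case True
      then show ?thesis using coset lift_derivation[OF v] \<theta> by auto
    next
      case False
      then show ?thesis using linear_functionals_coset(3)[OF lin] by (simp add: lift_functional_def)
    qed
  qed
qed

text \<open>The two actions on the complex numbers coincide because multiplication of complex
  numbers is commutative.\<close>

lemma coboundaries_trivial: "coboundaries1 A eps = {\<lambda>_. 0}"
  unfolding coboundaries1_def by (auto simp: fun_eq_iff image_iff)

lemma cohomology_class_singleton:
  assumes "\<eta> \<in> cocycles1 A eps"
  shows "cohomology_class1 A eps \<eta> = {\<eta>}"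
  using assms by (auto simp: cohomology_class1_def coboundaries_trivial fun_eq_iff)

lemma first_cohomology_isI:
  fixes P :: "complex^'n^'n \<Rightarrow> bool"
  assumes sol: "\<And>v. v \<in> solutions C \<longleftrightarrow> P v" and size: "basis_size {v. P v} m" and b: "b = real m"
  shows "first_cohomology_is C P b"
proof -
  let ?A = "easy_algebra C :: (complex, 'n poly_alg set) module"
  let ?eps = "easy_counit C :: 'n poly_alg set \<Rightarrow> complex"
  let ?mat = "\<lambda>\<eta>. (\<chi> j i. \<eta> (easy_u C White j i)) :: complex^'n^'n"
  let ?\<Phi> = "\<lambda>X. ?mat (the_elem X)"
  have single: "cohomology_class1 ?A ?eps \<eta> = {\<eta>}" if "\<eta> \<in> cocycles" for \<eta>
    using cohomology_class_singleton[OF that] .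
  have H: "cohomology1 ?A ?eps = (\<lambda>\<eta>. {\<eta>}) ` cocycles"
    unfolding cohomology1_def using single by (intro image_cong refl) auto
  have inj: "inj_on ?\<Phi> ((\<lambda>\<eta>. {\<eta>}) ` cocycles)"
  proof (rule inj_onI)
    fix X Y assume "X \<in> (\<lambda>\<eta>. {\<eta>}) ` cocycles" "Y \<in> (\<lambda>\<eta>. {\<eta>}) ` cocycles" and eq: "?\<Phi> X = ?\<Phi> Y"
    then obtain \<eta> \<xi> where *: "\<eta> \<in> cocycles" "\<xi> \<in> cocycles" "X = {\<eta>}" "Y = {\<xi>}" by blast
    have "?mat \<eta> = ?mat \<xi>" using eq * by simp
    then have "\<eta> = \<xi>" using solution_of_cocycle(2)[OF *(1)] solution_of_cocycle(2)[OF *(2)] by metis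
    then show "X = Y" using * by simp
  qed
  have surj: "?\<Phi> ` (\<lambda>\<eta>. {\<eta>}) ` cocycles = {v. P v}"
  proof (intro equalityI subsetI)
    fix v assume "v \<in> ?\<Phi> ` (\<lambda>\<eta>. {\<eta>}) ` cocycles"
    then obtain \<eta> where "\<eta> \<in> cocycles" "v = ?mat \<eta>" by auto
    then show "v \<in> {v. P v}" using solution_of_cocycle(1) sol by blast
  next
    fix v assume "v \<in> {v. P v}"
    then have v: "v \<in> solutions C" using sol by simp
    let ?\<eta> = "lift_functional C (derivation (matrix_values v))"
    have "v = ?\<Phi> {?\<eta>}" using cocycle_of_solution(2)[OF v] by simp
    then show "v \<in> ?\<Phi> ` (\<lambda>\<eta>. {\<eta>}) ` cocycles" using cocycle_of_solution(1)[OF v] by blast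
  qed
  have add: "class_add {\<eta>} {\<xi>} = {\<lambda>a. \<eta> a + \<xi> a}" for \<eta> \<xi> :: "'n poly_alg set \<Rightarrow> complex"
    by (auto simp: class_add_def)
  have scale: "class_scale ?A ?eps z {\<eta>} = {\<lambda>a. z * \<eta> a}" for z \<eta>
    by (simp add: class_scale_def coboundaries_trivial)
  show ?thesis
    unfolding first_cohomology_is_def Let_def
  proof (intro conjI exI[of _ ?\<Phi>])
    show "cmat.subspace {v. P v}" using size by (simp add: basis_size_def)
    show "real (cmat.dim {v. P v}) = b" using basis_size_dim[OF size] b by simp
    show "\<forall>\<eta>\<in>cocycles. ?\<Phi> (cohomology_class1 ?A ?eps \<eta>) = ?mat \<eta>" using single by simp
    show "bij_betw ?\<Phi> (cohomology1 ?A ?eps) {v. P v}" unfolding bij_betw_def H using inj surj by blast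
    show "\<forall>X\<in>cohomology1 ?A ?eps. \<forall>Y\<in>cohomology1 ?A ?eps. ?\<Phi> (class_add X Y) = ?\<Phi> X + ?\<Phi> Y"
      unfolding H by (auto simp: add vec_eq_iff)
    show "\<forall>z. \<forall>X\<in>cohomology1 ?A ?eps. ?\<Phi> (class_scale ?A ?eps z X) = cmat_scale z (?\<Phi> X)"
      unfolding H by (auto simp: scale vec_eq_iff)
  qed
qed

end

section \<open>The ten cases\<close>

lemma small_iff_line_sums: "small v \<longleftrightarrow> line_sums v 0"
  by (simp add: small_def line_sums_def)

lemma small_minus_scalar: "small (v - mat z) \<longleftrightarrow> line_sums v z"
proof -
  have "(\<Sum>x\<in>UNIV. (v - mat z) $ a $ x) = (\<Sum>x\<in>UNIV. v $ a $ x) - z"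
    "(\<Sum>x\<in>UNIV. (v - mat z) $ x $ a) = (\<Sum>x\<in>UNIV. v $ x $ a) - z" for a
    by (simp_all add: mat_def sum_subtractf)
  then show ?thesis by (simp add: small_def line_sums_def)
qed

lemma skew_minus_scalar:
  "skew_symmetric (v - mat z) \<longleftrightarrow> (\<forall>a. v $ a $ a = z) \<and> off_diagonal_skew v"
proof -
  have ent: "(v - mat z) $ a $ b = v $ a $ b - of_bool (a = b) * z" for a b by (simp add: mat_def)
  have diag: "v $ a $ a - z = - (v $ a $ a - z) \<longleftrightarrow> v $ a $ a = z" for a
    using eq_neg_iff_add_eq_0[of "v $ a $ a - z" "v $ a $ a - z"] by (simp only: mult_2[symmetric]) simp
  show ?thesis
  proof
    assume s: "skew_symmetric (v - mat z)"
    have s: "v $ a $ b - of_bool (a = b) * z = - (v $ b $ a - of_bool (b = a) * z)" for a b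
      using s unfolding skew_symmetric_iff ent by blast
    show "(\<forall>a. v $ a $ a = z) \<and> off_diagonal_skew v"
      unfolding off_diagonal_skew_def
    proof (intro conjI allI impI)
      show "v $ a $ a = z" for a using s[of a a] diag[of a] by simp
      show "v $ a $ b + v $ b $ a = 0" if "a \<noteq> b" for a b using s[of a b] that by simp
    qed
  next
    assume s: "(\<forall>a. v $ a $ a = z) \<and> off_diagonal_skew v"
    show "skew_symmetric (v - mat z)"
      unfolding skew_symmetric_iff ent
    proof (intro allI)
      fix a b
      show "v $ a $ b - of_bool (a = b) * z = - (v $ b $ a - of_bool (b = a) * z)"
      proof (cases "a = b")
        case True
        then show ?thesis using s by simp
      next
        case False
        then have "v $ a $ b + v $ b $ a = 0" using s unfolding off_diagonal_skew_def by blast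
        then show ?thesis using False by (simp add: eq_neg_iff_add_eq_0)
      qed
    qed
  qed
qed

lemma skew_iff: "skew_symmetric v \<longleftrightarrow> (\<forall>a. v $ a $ a = 0) \<and> off_diagonal_skew v"
  using skew_minus_scalar[of v 0] by (simp add: mat_eq_scale[of 0])

text \<open>The sum of all entries of \<open>v\<close> is \<open>n y\<close> by rows, and \<open>n
  z\<close> because the off-diagonal entries cancel in pairs.\<close>

lemma line_sum_eq_diagonal:
  fixes v :: "complex^'n^'n"
  assumes sums: "line_sums v y" and diag: "\<forall>a. v $ a $ a = z" and skew: "off_diagonal_skew v"
  shows "y = z"
proof -
  define u where "u = v - mat z"
  have row: "(\<Sum>x\<in>UNIV. u $ a $ x) = y - z" for a
    using sums by (simp add: u_def mat_def sum_subtractf line_sums_def)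
  have "skew_symmetric u" unfolding u_def skew_minus_scalar using diag skew by simp
  then have u: "u $ a $ x = - u $ x $ a" for a x unfolding skew_symmetric_iff by blast
  let ?T = "\<Sum>a\<in>UNIV. \<Sum>x\<in>UNIV. u $ a $ x"
  have "?T = (\<Sum>a\<in>UNIV. \<Sum>x\<in>UNIV. - u $ x $ a)" by (intro sum.cong refl u)
  also have "\<dots> = - (\<Sum>a\<in>UNIV. \<Sum>x\<in>UNIV. u $ x $ a)" by (simp only: sum_negf)
  also have "(\<Sum>a\<in>UNIV. \<Sum>x\<in>UNIV. u $ x $ a) = ?T" by (rule sum.swap)
  finally have "?T + ?T = 0" by (simp only: eq_neg_iff_add_eq_0)
  then have "?T = 0" by (simp only: mult_2[symmetric]) simp
  moreover have "?T = of_nat CARD('n) * (y - z)" unfolding row by simp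
  ultimately show ?thesis by simp
qed

lemma scalar_iff: "v - mat z = 0 \<longleftrightarrow> (\<forall>a. v $ a $ a = z) \<and> off_diagonal_zero v"
proof
  assume "v - mat z = 0"
  then have "v = mat z" by simp
  then show "(\<forall>a. v $ a $ a = z) \<and> off_diagonal_zero v" by (simp add: off_diagonal_zero_def mat_def)
next
  assume v: "(\<forall>a. v $ a $ a = z) \<and> off_diagonal_zero v"
  have "v $ a $ b = mat z $ a $ b" for a b
    using v by (cases "a = b") (simp_all add: off_diagonal_zero_def mat_def)
  then show "v - mat z = 0" by (simp add: vec_eq_iff)
qed

lemma zero_matrix_iff: "v = 0 \<longleftrightarrow> (\<forall>a. v $ a $ a = 0) \<and> off_diagonal_zero v"
  using scalar_iff[of v 0] by (simp add: mat_eq_scale[of 0])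

lemma diagonal_iff: "diagonal_matrix v \<longleftrightarrow> off_diagonal_zero v"
  by (simp add: diagonal_matrix_def off_diagonal_zero_def)

lemma line_sums_scalar:
  assumes "\<forall>a. v $ a $ a = z" "off_diagonal_zero v"
  shows "line_sums v z"
proof -
  have "v - mat z = 0" using assms scalar_iff by blast
  then have "small (v - mat z)" by (simp add: small_def)
  then show ?thesis by (simp only: small_minus_scalar)
qed

lemma not_small_one: "\<not> small (mat 1 :: complex^'n^'n)"
  by (simp add: small_def mat_def)

lemma not_skew_one: "\<not> skew_symmetric (mat 1 :: complex^'n^'n)"
  by (simp add: skew_iff mat_def)

lemma property4_of_2_and_3:
  assumes "partition_category C" "property2 C" "property3 C"
  shows "property4 C"
  unfolding property4_iff_charge[OF assms(1)]
proof (intro allI impI)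
  fix c d p assume p: "(c, d, p) \<in> C"
  have "charge (white_lower_black_upper c d) B = 0" if "B \<in> p" for B
    using assms p that unfolding property2_def property3_iff_charge[OF assms(1)] by blast
  then show "charge (white_lower_black_upper c d) (points (length c) (length d)) = 0"
    using charge_total[OF in_category_partition[OF assms(1) p] finite_points] by simp
qed

theorem mainTheorem1:
  fixes C :: "tcp set" and n :: nat
  assumes category: "partition_category C"
    and n: "n = CARD('n::finite)"
  shows
    "(property1 C \<and> property2 C \<and> property3 C \<longrightarrow>
       first_cohomology_is C (\<lambda>v :: complex^'n^'n. True) ((real n)\<^sup>2)) \<and>
     (property1 C \<and> \<not> property2 C \<and> property3 C \<and> property4 C \<longrightarrow>
       first_cohomology_is C (\<lambda>v :: complex^'n^'n. \<exists>z. small (v - mat z))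
         ((real n - 1)\<^sup>2 + 1)) \<and>
     (property1 C \<and> \<not> property2 C \<and> property3 C \<and> \<not> property4 C \<longrightarrow>
       first_cohomology_is C (\<lambda>v :: complex^'n^'n. small v) ((real n - 1)\<^sup>2)) \<and>
     (property1 C \<and> property2 C \<and> \<not> property3 C \<and> property4 C \<longrightarrow>
       first_cohomology_is C (\<lambda>v :: complex^'n^'n. \<exists>z. skew_symmetric (v - mat z))
         (1 / 2 * real n * (real n - 1) + 1)) \<and>
     (property1 C \<and> property2 C \<and> \<not> property3 C \<and> \<not> property4 C \<longrightarrow>
       first_cohomology_is C (\<lambda>v :: complex^'n^'n. skew_symmetric v)
         (1 / 2 * real n * (real n - 1))) \<and>
     (property1 C \<and> \<not> property2 C \<and> \<not> property3 C \<and> property4 C \<longrightarrow>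
       first_cohomology_is C
         (\<lambda>v :: complex^'n^'n. \<exists>z. skew_symmetric (v - mat z) \<and> small (v - mat z))
         (1 / 2 * (real n - 1) * (real n - 2) + 1)) \<and>
     (property1 C \<and> \<not> property2 C \<and> \<not> property3 C \<and> \<not> property4 C \<longrightarrow>
       first_cohomology_is C (\<lambda>v :: complex^'n^'n. skew_symmetric v \<and> small v)
         (1 / 2 * (real n - 1) * (real n - 2))) \<and>
     (\<not> property1 C \<and> property2 C \<and> property3 C \<and> property4 C \<longrightarrow>
       first_cohomology_is C (\<lambda>v :: complex^'n^'n. diagonal_matrix v) (real n)) \<and>
     (\<not> property1 C \<and> \<not> property3 C \<and> property4 C \<longrightarrow>
       first_cohomology_is C (\<lambda>v :: complex^'n^'n. \<exists>z. v - mat z = 0) 1) \<and>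
     (\<not> property1 C \<and> \<not> property3 C \<and> \<not> property4 C \<longrightarrow>
       first_cohomology_is C (\<lambda>v :: complex^'n^'n. v = 0) 0) \<and>
     (property1 C \<and> property2 C \<and> property3 C \<or>
      property1 C \<and> \<not> property2 C \<and> property3 C \<and> property4 C \<or>
      property1 C \<and> \<not> property2 C \<and> property3 C \<and> \<not> property4 C \<or>
      property1 C \<and> property2 C \<and> \<not> property3 C \<and> property4 C \<or>
      property1 C \<and> property2 C \<and> \<not> property3 C \<and> \<not> property4 C \<or>
      property1 C \<and> \<not> property2 C \<and> \<not> property3 C \<and> property4 C \<or>
      property1 C \<and> \<not> property2 C \<and> \<not> property3 C \<and> \<not> property4 C \<or>
      \<not> property1 C \<and> property2 C \<and> property3 C \<and> property4 C \<or>
      \<not> property1 C \<and> \<not> property3 C \<and> property4 C \<or>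
      \<not> property1 C \<and> \<not> property3 C \<and> \<not> property4 C)"
proof (intro conjI impI; (elim conjE)?)
  note main = first_cohomology_isI[OF category]
  show "first_cohomology_is C (\<lambda>v :: complex^'n^'n. True) ((real n)\<^sup>2)"
    if p: "property1 C" "property2 C" "property3 C"
  proof (rule main)
    show "v \<in> solutions C \<longleftrightarrow> True" for v :: "complex^'n^'n"
      using solutionsI[OF category, of v 0] p by simp
    show "basis_size {v :: complex^'n^'n. True} (CARD('n) ^ 2)" by (rule basis_size_all)
  qed (simp add: n)
  show "first_cohomology_is C (\<lambda>v :: complex^'n^'n. \<exists>z. small (v - mat z)) ((real n - 1)\<^sup>2 + 1)"
    if p: "property1 C" "\<not> property2 C" "property3 C" "property4 C"
  proof (rule main)
    show "v \<in> solutions C \<longleftrightarrow> (\<exists>z. small (v - mat z))" for v :: "complex^'n^'n"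
      unfolding small_minus_scalar
    proof
      show "\<exists>z. line_sums v z" if "v \<in> solutions C"
        by (rule solution_line_sums[OF category that \<open>\<not> property2 C\<close>])
      assume "\<exists>z. line_sums v z"
      then obtain z where "line_sums v z" ..
      then show "v \<in> solutions C" by (intro solutionsI[OF category, where z = z]) (use p in simp_all)
    qed
    show "basis_size {v :: complex^'n^'n. \<exists>z. small (v - mat z)} ((CARD('n) - 1) ^ 2 + 1)"
      by (rule basis_size_plus_scalars[OF basis_size_small not_small_one])
  qed (simp add: n of_nat_diff)
  show "first_cohomology_is C (\<lambda>v :: complex^'n^'n. small v) ((real n - 1)\<^sup>2)"
    if p: "property1 C" "\<not> property2 C" "property3 C" "\<not> property4 C"
  proof (rule main)
    show "v \<in> solutions C \<longleftrightarrow> small v" for v :: "complex^'n^'n"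
      unfolding small_iff_line_sums
    proof
      assume v: "v \<in> solutions C"
      obtain z where z: "line_sums v z" using solution_line_sums[OF category v p(2)] ..
      have "z = 0" by (rule solution_scalar_zero[OF category v]) (use p z in simp_all)
      then show "line_sums v 0" using z by simp
    next
      assume "line_sums v 0"
      then show "v \<in> solutions C" by (intro solutionsI[OF category, where z = 0]) (use p in simp_all)
    qed
    show "basis_size {v :: complex^'n^'n. small v} ((CARD('n) - 1) ^ 2)" by (rule basis_size_small)
  qed (simp add: n of_nat_diff)
  obtain m where m: "basis_size {v :: complex^'n^'n. skew_symmetric v} m"
      "real m = 1 / 2 * real n * (real n - 1)"
    using basis_size_skew unfolding n by blast
  show "first_cohomology_is C (\<lambda>v :: complex^'n^'n. \<exists>z. skew_symmetric (v - mat z))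
      (1 / 2 * real n * (real n - 1) + 1)"
    if p: "property1 C" "property2 C" "\<not> property3 C" "property4 C"
  proof (rule main)
    show "v \<in> solutions C \<longleftrightarrow> (\<exists>z. skew_symmetric (v - mat z))" for v :: "complex^'n^'n"
      unfolding skew_minus_scalar
    proof
      assume v: "v \<in> solutions C"
      obtain z where "\<forall>a. v $ a $ a = z" using solution_diagonal_constant[OF category v p(3)] ..
      then show "\<exists>z. (\<forall>a. v $ a $ a = z) \<and> off_diagonal_skew v"
        using solution_off_diagonal_skew[OF category v p(1,3)] by blast
    next
      assume "\<exists>z. (\<forall>a. v $ a $ a = z) \<and> off_diagonal_skew v"
      then obtain z where "\<forall>a. v $ a $ a = z" "off_diagonal_skew v" by blast
      then show "v \<in> solutions C" by (intro solutionsI[OF category, where z = z]) (use p in simp_all)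
    qed
    show "basis_size {v :: complex^'n^'n. \<exists>z. skew_symmetric (v - mat z)} (m + 1)"
      by (rule basis_size_plus_scalars[OF m(1) not_skew_one])
  qed (simp add: m(2))
  show "first_cohomology_is C (\<lambda>v :: complex^'n^'n. skew_symmetric v) (1 / 2 * real n * (real n - 1))"
    if p: "property1 C" "property2 C" "\<not> property3 C" "\<not> property4 C"
  proof (rule main)
    show "v \<in> solutions C \<longleftrightarrow> skew_symmetric v" for v :: "complex^'n^'n"
    proof
      assume v: "v \<in> solutions C"
      obtain z where z: "\<forall>a. v $ a $ a = z" using solution_diagonal_constant[OF category v p(3)] ..
      have "z = 0" by (rule solution_scalar_zero[OF category v]) (use p z in simp_all)
      then show "skew_symmetric v"
        unfolding skew_iff using z solution_off_diagonal_skew[OF category v p(1,3)] by simp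
    next
      assume "skew_symmetric v"
      then show "v \<in> solutions C"
        unfolding skew_iff by (intro solutionsI[OF category, where z = 0]) (use p in simp_all)
    qed
    show "basis_size {v :: complex^'n^'n. skew_symmetric v} m" by (rule m(1))
  qed (simp add: m(2))
  obtain m' where m': "basis_size {v :: complex^'n^'n. skew_symmetric v \<and> small v} m'"
      "real m' = 1 / 2 * (real n - 1) * (real n - 2)"
    using basis_size_skew_small unfolding n by blast
  have both: "\<exists>z. (\<forall>a. v $ a $ a = z) \<and> off_diagonal_skew v \<and> line_sums v z"
    if p: "v \<in> solutions C" "property1 C" "\<not> property2 C" "\<not> property3 C" for v :: "complex^'n^'n"
  proof -
    obtain y where y: "line_sums v y" using solution_line_sums[OF category p(1,3)] ..
    obtain z where z: "\<forall>a. v $ a $ a = z" using solution_diagonal_constant[OF category p(1,4)] ..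
    have skew: "off_diagonal_skew v" by (rule solution_off_diagonal_skew[OF category p(1,2,4)])
    have "y = z" by (rule line_sum_eq_diagonal[OF y z skew])
    then show ?thesis using y z skew by blast
  qed
  show "first_cohomology_is C
      (\<lambda>v :: complex^'n^'n. \<exists>z. skew_symmetric (v - mat z) \<and> small (v - mat z))
      (1 / 2 * (real n - 1) * (real n - 2) + 1)"
    if p: "property1 C" "\<not> property2 C" "\<not> property3 C" "property4 C"
  proof (rule main)
    show "v \<in> solutions C \<longleftrightarrow> (\<exists>z. skew_symmetric (v - mat z) \<and> small (v - mat z))"
      for v :: "complex^'n^'n"
    proof
      assume "v \<in> solutions C"
      from both[OF this p(1,2,3)] show "\<exists>z. skew_symmetric (v - mat z) \<and> small (v - mat z)"
        unfolding skew_minus_scalar small_minus_scalar by (simp only: conj_assoc)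
    next
      assume "\<exists>z. skew_symmetric (v - mat z) \<and> small (v - mat z)"
      then obtain z where "\<forall>a. v $ a $ a = z" "off_diagonal_skew v" "line_sums v z"
        unfolding skew_minus_scalar small_minus_scalar by blast
      then show "v \<in> solutions C" by (intro solutionsI[OF category, where z = z]) (use p in simp_all)
    qed
    show "basis_size {v :: complex^'n^'n. \<exists>z. skew_symmetric (v - mat z) \<and> small (v - mat z)} (m' + 1)"
      by (rule basis_size_plus_scalars[OF m'(1)]) (simp add: not_skew_one)
  qed (simp add: m'(2))
  show "first_cohomology_is C (\<lambda>v :: complex^'n^'n. skew_symmetric v \<and> small v)
      (1 / 2 * (real n - 1) * (real n - 2))"
    if p: "property1 C" "\<not> property2 C" "\<not> property3 C" "\<not> property4 C"
  proof (rule main)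
    show "v \<in> solutions C \<longleftrightarrow> skew_symmetric v \<and> small v" for v :: "complex^'n^'n"
    proof
      assume v: "v \<in> solutions C"
      obtain z where z: "\<forall>a. v $ a $ a = z" "off_diagonal_skew v" "line_sums v z"
        using both[OF v p(1,2,3)] by blast
      have "z = 0" by (rule solution_scalar_zero[OF category v]) (use p z in simp_all)
      then show "skew_symmetric v \<and> small v" unfolding skew_iff small_iff_line_sums using z by simp
    next
      assume "skew_symmetric v \<and> small v"
      then show "v \<in> solutions C"
        unfolding skew_iff small_iff_line_sums
        by (intro solutionsI[OF category, where z = 0]) (use p in simp_all)
    qed
    show "basis_size {v :: complex^'n^'n. skew_symmetric v \<and> small v} m'" by (rule m'(1))
  qed (simp add: m'(2))
  show "first_cohomology_is C (\<lambda>v :: complex^'n^'n. diagonal_matrix v) (real n)"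
    if p: "\<not> property1 C" "property2 C" "property3 C" "property4 C"
  proof (rule main)
    show "v \<in> solutions C \<longleftrightarrow> diagonal_matrix v" for v :: "complex^'n^'n"
      unfolding diagonal_iff
    proof
      show "off_diagonal_zero v" if "v \<in> solutions C"
        by (rule solution_off_diagonal_zero[OF category that \<open>\<not> property1 C\<close>])
      assume "off_diagonal_zero v"
      then show "v \<in> solutions C" by (intro solutionsI[OF category, where z = 0]) (use p in simp_all)
    qed
    show "basis_size {v :: complex^'n^'n. diagonal_matrix v} CARD('n)" by (rule basis_size_diagonal)
  qed (simp add: n)
  show "first_cohomology_is C (\<lambda>v :: complex^'n^'n. \<exists>z. v - mat z = 0) 1"
    if p: "\<not> property1 C" "\<not> property3 C" "property4 C"
  proof (rule main)
    show "v \<in> solutions C \<longleftrightarrow> (\<exists>z. v - mat z = 0)" for v :: "complex^'n^'n"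
      unfolding scalar_iff
    proof
      assume v: "v \<in> solutions C"
      obtain z where "\<forall>a. v $ a $ a = z" using solution_diagonal_constant[OF category v p(2)] ..
      then show "\<exists>z. (\<forall>a. v $ a $ a = z) \<and> off_diagonal_zero v"
        using solution_off_diagonal_zero[OF category v p(1)] by blast
    next
      assume "\<exists>z. (\<forall>a. v $ a $ a = z) \<and> off_diagonal_zero v"
      then obtain z where z: "\<forall>a. v $ a $ a = z" "off_diagonal_zero v" by blast
      then show "v \<in> solutions C"
        by (intro solutionsI[OF category, where z = z]) (use p line_sums_scalar[OF z] in simp_all)
    qed
    show "basis_size {v :: complex^'n^'n. \<exists>z. v - mat z = 0} (0 + 1)"
      by (rule basis_size_plus_scalars[OF basis_size_zero]) (simp add: zero_matrix_iff mat_def)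
  qed simp
  show "first_cohomology_is C (\<lambda>v :: complex^'n^'n. v = 0) 0"
    if p: "\<not> property1 C" "\<not> property3 C" "\<not> property4 C"
  proof (rule main)
    show "v \<in> solutions C \<longleftrightarrow> v = 0" for v :: "complex^'n^'n"
    proof
      assume v: "v \<in> solutions C"
      obtain z where z: "\<forall>a. v $ a $ a = z" using solution_diagonal_constant[OF category v p(2)] ..
      have off: "off_diagonal_zero v" by (rule solution_off_diagonal_zero[OF category v p(1)])
      have "z = 0"
        by (rule solution_scalar_zero[OF category v]) (use p z line_sums_scalar[OF z off] in simp_all)
      then show "v = 0" unfolding zero_matrix_iff using z off by simp
    qed (simp add: zero_solution)
    show "basis_size {v :: complex^'n^'n. v = 0} 0" by (rule basis_size_zero)
  qed simp
qed (use property_2_of_not_1_and_3[OF category] property4_of_2_and_3[OF category] in blast)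

end
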